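(* Let $P$ be the Markov kernel of a non-reversible $\phi$-irreducible Markov chain on $(\mathcal X,\mathcal F)$ with stationary distribution $\pi$. Assume that $P(x,\cdot)$, $P^*(x,\cdot)$ ($x\in\mathcal X$) and $\pi$ are absolutely continuous with respect to a common reference measure $\mu$ on $(\mathcal X,\mathcal F)$, with densities $p(x,\cdot)$, $p^*(x,\cdot)$, $\pi(\cdot)$, and that $\{x:\pi(x)=0\}$ is a $\mu$-null set. Let $M_1,M_2$ be the first and second Metropolis-Hastings (MH) kernels of $P$. Suppose that for $i=1,2$, $M_i$ satisfies the dominant-eigenvalue assumption (stated in the context) with $n$ dominant eigenvalues and eigenvectors $(\lambda_j^{(i)},\phi_j^{(i)})_{j=1}^n$. Then for any partition $\mathcal D=\{A_1,\dots,A_n\}$ of $\mathcal X$ into measurable sets, the metastability of $\mathcal D$ is bounded by $$1+\sum_{j=2}^n\rho_j\lambda_j^{(2)}+c\ \le\ m(\mathcal D)\ \le\ 1+\sum_{j=2}^n\lambda_j^{(1)},$$ where $\Gamma$ is the orthogonal projection from $L^2(\pi)$ onto $\mathrm{Span}\{\mathbf 1_{A_1},\dots,\mathbf 1_{A_n}\}$, $\rho_j:=\|\Gamma\phi_j^{(2)}\|_\pi^2\in[0,1]$ for $j=2,\dots,n$, and $$c:=a\sum_{j=2}^n(1-\rho_j),$$ with $a$ the constant in the dominant-eigenvalue assumption for $M_2$.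
   Context: $L^2(\pi)$ has inner product $\langle f,g\rangle_\pi=\int f\overline g\,d\pi$. The time-reversal $P^*$ is the adjoint of $P$: $\pi(dx)P^*(x,dy)=\pi(dy)P(y,dx)$. The MH kernels are $$M_1(x,dy)=\min\{p(x,y),p^*(x,y)\}\mu(dy)+r_1(x)\delta_x(dy),\quad M_2(x,dy)=\max\{p(x,y),p^*(x,y)\}\mu(dy)-r_1(x)\delta_x(dy),$$ with $r_1(x)=\int_{y\ne x}(p(x,y)-\min\{p(x,y),p^*(x,y)\})\mu(dy)$. Metastability: for $A,B\in\mathcal F$, $Q(A,B):=\frac{1}{\pi(A)}\int_AP(x,B)\,\pi(dx)$ if $\pi(A)>0$ and $0$ otherwise; $m(\mathcal D):=\sum_{i=1}^nQ(A_i,A_i)$. Dominant-eigenvalue assumption for a kernel $Q$: $Q:L^2(\pi)\to L^2(\pi)$ is a self-adjoint Markov kernel with $n$ eigenvalues $1=\lambda_1>\lambda_2\ge\dots\ge\lambda_n$ (listed with multiplicity), and its spectrum satisfies $\sigma(Q)\subset[a,b]\cup\{\lambda_n,\dots,\lambda_1\}$ where $-1<a\le b<\lambda_n$. The eigenvalues $\lambda_1,\dots,\lambda_n$ are called dominant; the corresponding eigenvectors are taken orthonormal in $L^2(\pi)$ with $\phi_1=\mathbf 1$.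
   Formalization: Every cell A_i of the partition is required to have positive measure π(A_i) > 0; with π-null cells (where Q is set to 0) the stated bounds can fail, e.g. the upper bound when dominant eigenvalues are negative. *)

theory Defs
  imports "HOL-Probability.Probability"
begin

text \<open>
  Elements of \<open>L\<^sup>2(\<pi>)\<close> are represented by complex functions; equality in \<open>L\<^sup>2(\<pi>)\<close> is equality
  \<open>\<pi>\<close>-almost everywhere.
\<close>

definition L2 :: "'a measure \<Rightarrow> ('a \<Rightarrow> complex) set" where
  "L2 \<pi> = {f. f \<in> borel_measurable \<pi> \<and> integrable \<pi> (\<lambda>x. (cmod (f x))\<^sup>2)}"

definition L2_inner :: "'a measure \<Rightarrow> ('a \<Rightarrow> complex) \<Rightarrow> ('a \<Rightarrow> complex) \<Rightarrow> complex" where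
  "L2_inner \<pi> f g = (LINT x|\<pi>. f x * cnj (g x))"

definition L2_norm :: "'a measure \<Rightarrow> ('a \<Rightarrow> complex) \<Rightarrow> real" where
  "L2_norm \<pi> f = sqrt (LINT x|\<pi>. (cmod (f x))\<^sup>2)"

text \<open>\<open>R\<close> below is the bounded, everywhere defined two-sided inverse of \<open>T - z\<close>.\<close>

definition L2_resolvent_set ::
    "'a measure \<Rightarrow> (('a \<Rightarrow> complex) \<Rightarrow> ('a \<Rightarrow> complex)) \<Rightarrow> complex set" where
  "L2_resolvent_set \<pi> T = {z. \<exists>R :: ('a \<Rightarrow> complex) \<Rightarrow> ('a \<Rightarrow> complex).
      (\<forall>g\<in>L2 \<pi>. R g \<in> L2 \<pi> \<and> (AE x in \<pi>. T (R g) x - z * R g x = g x)) \<and>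
      (\<forall>f\<in>L2 \<pi>. AE x in \<pi>. R (\<lambda>y. T f y - z * f y) x = f x) \<and>
      (\<exists>C. \<forall>g\<in>L2 \<pi>. L2_norm \<pi> (R g) \<le> C * L2_norm \<pi> g)}"

definition L2_spectrum ::
    "'a measure \<Rightarrow> (('a \<Rightarrow> complex) \<Rightarrow> ('a \<Rightarrow> complex)) \<Rightarrow> complex set" where
  "L2_spectrum \<pi> T = - L2_resolvent_set \<pi> T"

definition indicator_span :: "nat \<Rightarrow> (nat \<Rightarrow> 'a set) \<Rightarrow> ('a \<Rightarrow> complex) set" where
  "indicator_span n A = {f. \<exists>c :: nat \<Rightarrow> complex. f = (\<lambda>x. \<Sum>i=1..n. c i * indicator (A i) x)}"

definition orthogonal_projection_onto ::
    "'a measure \<Rightarrow> ('a \<Rightarrow> complex) set \<Rightarrow> (('a \<Rightarrow> complex) \<Rightarrow> ('a \<Rightarrow> complex)) \<Rightarrow> bool" where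
  "orthogonal_projection_onto \<pi> V \<Gamma> \<longleftrightarrow>
     (\<forall>f\<in>L2 \<pi>. \<Gamma> f \<in> V \<and> (\<forall>v\<in>V. L2_inner \<pi> (\<lambda>x. f x - \<Gamma> f x) v = 0))"

definition markov_kernel :: "'a measure \<Rightarrow> ('a \<Rightarrow> 'a measure) \<Rightarrow> bool" where
  "markov_kernel S K \<longleftrightarrow> K \<in> S \<rightarrow>\<^sub>M prob_algebra S"

definition kernel_op :: "('a \<Rightarrow> 'a measure) \<Rightarrow> ('a \<Rightarrow> complex) \<Rightarrow> ('a \<Rightarrow> complex)" where
  "kernel_op K f = (\<lambda>x. LINT y|K x. f y)"

definition stationary :: "'a measure \<Rightarrow> ('a \<Rightarrow> 'a measure) \<Rightarrow> bool" where
  "stationary \<pi> P \<longleftrightarrow> \<pi> \<bind> P = \<pi>"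

text \<open>The identity \<open>\<pi>(dx) P\<^sup>*(x,dy) = \<pi>(dy) P(y,dx)\<close>, tested on measurable rectangles.\<close>

definition time_reversal :: "'a measure \<Rightarrow> ('a \<Rightarrow> 'a measure) \<Rightarrow> ('a \<Rightarrow> 'a measure) \<Rightarrow> bool" where
  "time_reversal \<pi> P Pstar \<longleftrightarrow>
     (\<forall>A\<in>sets \<pi>. \<forall>B\<in>sets \<pi>.
        (\<integral>\<^sup>+x\<in>A. emeasure (Pstar x) B \<partial>\<pi>) = (\<integral>\<^sup>+y\<in>B. emeasure (P y) A \<partial>\<pi>))"

definition reversible :: "'a measure \<Rightarrow> ('a \<Rightarrow> 'a measure) \<Rightarrow> bool" where
  "reversible \<pi> P \<longleftrightarrow> time_reversal \<pi> P P"

text \<open>\<open>kernel_pow P k x\<close> is the law of the chain started at \<open>x\<close> after \<open>k + 1\<close> steps.\<close>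

definition kernel_pow :: "('a \<Rightarrow> 'a measure) \<Rightarrow> nat \<Rightarrow> 'a \<Rightarrow> 'a measure" where
  "kernel_pow P k x = ((\<lambda>\<nu>. \<nu> \<bind> P) ^^ k) (P x)"

definition phi_irreducible :: "'a measure \<Rightarrow> ('a \<Rightarrow> 'a measure) \<Rightarrow> bool" where
  "phi_irreducible S P \<longleftrightarrow>
     (\<exists>\<phi>. sets \<phi> = sets S \<and> sigma_finite_measure \<phi> \<and> emeasure \<phi> (space \<phi>) > 0 \<and>
        (\<forall>A\<in>sets S. emeasure \<phi> A > 0 \<longrightarrow>
           (\<forall>x\<in>space S. \<exists>k. emeasure (kernel_pow P k x) A > 0)))"

definition has_density :: "'a measure \<Rightarrow> 'a measure \<Rightarrow> ('a \<Rightarrow> real) \<Rightarrow> bool" where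
  "has_density \<mu> \<nu> f \<longleftrightarrow>
     f \<in> borel_measurable \<mu> \<and> (\<forall>y\<in>space \<mu>. 0 \<le> f y) \<and> \<nu> = density \<mu> (\<lambda>y. ennreal (f y))"

text \<open>
  The Metropolis-Hastings kernels are first given as real-valued set functions, because in general
  the second one is only a signed kernel; that it is a Markov kernel is part of the
  dominant-eigenvalue assumption.  Below, \<open>p\<close> and \<open>q\<close> are the densities of \<open>P\<close> and \<open>P\<^sup>*\<close>.
\<close>

definition mh_r :: "'a measure \<Rightarrow> ('a \<Rightarrow> 'a \<Rightarrow> real) \<Rightarrow> ('a \<Rightarrow> 'a \<Rightarrow> real) \<Rightarrow> 'a \<Rightarrow> real" where
  "mh_r \<mu> p q x = (LINT y:space \<mu> - {x}|\<mu>. p x y - min (p x y) (q x y))"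

definition mh1 ::
    "'a measure \<Rightarrow> ('a \<Rightarrow> 'a \<Rightarrow> real) \<Rightarrow> ('a \<Rightarrow> 'a \<Rightarrow> real) \<Rightarrow> 'a \<Rightarrow> 'a set \<Rightarrow> real" where
  "mh1 \<mu> p q x A = (LINT y:A|\<mu>. min (p x y) (q x y)) + mh_r \<mu> p q x * indicator A x"

definition mh2 ::
    "'a measure \<Rightarrow> ('a \<Rightarrow> 'a \<Rightarrow> real) \<Rightarrow> ('a \<Rightarrow> 'a \<Rightarrow> real) \<Rightarrow> 'a \<Rightarrow> 'a set \<Rightarrow> real" where
  "mh2 \<mu> p q x A = (LINT y:A|\<mu>. max (p x y) (q x y)) - mh_r \<mu> p q x * indicator A x"

definition represents_kernel ::
    "'a measure \<Rightarrow> ('a \<Rightarrow> 'a measure) \<Rightarrow> ('a \<Rightarrow> 'a set \<Rightarrow> real) \<Rightarrow> bool" where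
  "represents_kernel S K k \<longleftrightarrow> (\<forall>x\<in>space S. \<forall>A\<in>sets S. measure (K x) A = k x A)"

text \<open>
  The dominant-eigenvalue assumption for \<open>K\<close>, with dominant eigenvalues \<open>lam 1, \<dots>, lam n\<close> and
  eigenvectors \<open>\<phi> 1, \<dots>, \<phi> n\<close>.  The last conjunct says that the eigenvalues are listed with their
  full multiplicity: the listed eigenvectors for a dominant eigenvalue span its eigenspace.
\<close>

definition dominant_eigenvalues ::
    "'a measure \<Rightarrow> ('a \<Rightarrow> 'a measure) \<Rightarrow> nat \<Rightarrow> (nat \<Rightarrow> real) \<Rightarrow> (nat \<Rightarrow> 'a \<Rightarrow> complex) \<Rightarrow>
      real \<Rightarrow> real \<Rightarrow> bool" where
  "dominant_eigenvalues \<pi> K n lam \<phi> a b \<longleftrightarrow>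
     markov_kernel \<pi> K \<and>
     (\<forall>f\<in>L2 \<pi>. kernel_op K f \<in> L2 \<pi>) \<and>
     (\<forall>f\<in>L2 \<pi>. \<forall>g\<in>L2 \<pi>. L2_inner \<pi> (kernel_op K f) g = L2_inner \<pi> f (kernel_op K g)) \<and>
     1 \<le> n \<and> lam 1 = 1 \<and> (\<forall>j\<in>{2..n}. lam j < lam 1) \<and>
     (\<forall>i\<in>{1..n}. \<forall>j\<in>{1..n}. i \<le> j \<longrightarrow> lam j \<le> lam i) \<and>
     -1 < a \<and> a \<le> b \<and> b < lam n \<and>
     L2_spectrum \<pi> (kernel_op K) \<subseteq> complex_of_real ` ({a..b} \<union> lam ` {1..n}) \<and>
     (\<forall>j\<in>{1..n}. \<phi> j \<in> L2 \<pi> \<and> (AE x in \<pi>. kernel_op K (\<phi> j) x = complex_of_real (lam j) * \<phi> j x)) \<and>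
     (\<forall>i\<in>{1..n}. \<forall>j\<in>{1..n}. L2_inner \<pi> (\<phi> i) (\<phi> j) = (if i = j then 1 else 0)) \<and>
     (AE x in \<pi>. \<phi> 1 x = 1) \<and>
     (\<forall>j\<in>{1..n}. \<forall>f\<in>L2 \<pi>.
        (AE x in \<pi>. kernel_op K f x = complex_of_real (lam j) * f x) \<longrightarrow>
        (\<exists>c :: nat \<Rightarrow> complex. AE x in \<pi>. f x = (\<Sum>k\<in>{k\<in>{1..n}. lam k = lam j}. c k * \<phi> k x)))"

definition transition_prob ::
    "'a measure \<Rightarrow> ('a \<Rightarrow> 'a measure) \<Rightarrow> 'a set \<Rightarrow> 'a set \<Rightarrow> real" where
  "transition_prob \<pi> P A B =
     (if measure \<pi> A > 0 then 1 / measure \<pi> A * (LINT x:A|\<pi>. measure (P x) B) else 0)"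

definition metastability ::
    "'a measure \<Rightarrow> ('a \<Rightarrow> 'a measure) \<Rightarrow> nat \<Rightarrow> (nat \<Rightarrow> 'a set) \<Rightarrow> real" where
  "metastability \<pi> P n A = (\<Sum>i=1..n. transition_prob \<pi> P (A i) (A i))"

text \<open>
  The cells of a partition are required to have positive \<open>\<pi>\<close>-mass.  If null cells were allowed,
  the indicators would span fewer than \<open>n\<close> dimensions and the metastability bounds could fail.
\<close>

definition measurable_partition :: "'a measure \<Rightarrow> nat \<Rightarrow> (nat \<Rightarrow> 'a set) \<Rightarrow> bool" where
  "measurable_partition \<pi> n A \<longleftrightarrow>
     (\<forall>i\<in>{1..n}. A i \<in> sets \<pi> \<and> measure \<pi> (A i) > 0) \<and>
     disjoint_family_on A {1..n} \<and> (\<Union>i\<in>{1..n}. A i) = space \<pi>"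

end

theory Submission
  imports Defs
begin

text \<open>
  For an orthonormal family \<open>e\<^sub>1, \<dots>, e\<^sub>n\<close> and a self-adjoint operator \<open>T\<close>, the partial trace
  \<open>\<Sum>\<^sub>i \<langle>T e\<^sub>i, e\<^sub>i\<rangle>\<close> is controlled by the spectrum of \<open>T\<close>. With \<open>e\<^sub>i = 1\<^bsub>A\<^sub>i\<^esub> / \<surd>\<pi>(A\<^sub>i)\<close> that trace
  is the metastability of the partition (\<open>metastability_trace\<close>), so spectral information about a
  self-adjoint kernel bounds its metastability. The kernel \<open>P\<close> is not self-adjoint, but its two
  Metropolis--Hastings kernels are, and they enclose it: away from the diagonal the first has the
  density \<open>min(p, p\<^sup>*) \<le> p\<close> and the second \<open>max(p, p\<^sup>*) \<ge> p\<close>. Hence, from a point of a cell,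
  the first leaves the cell with at most, and the second with at least, the probability with
  which \<open>P\<close> does (\<open>mh_holding_probability\<close>). So the metastability of \<open>P\<close> lies between those of the
  second and the first kernel.

  For a self-adjoint kernel with dominant eigenpairs \<open>(\<lambda>\<^sub>j, \<phi>\<^sub>j)\<close>, split \<open>f = \<Sum>\<^sub>j \<langle>f, \<phi>\<^sub>j\<rangle> \<phi>\<^sub>j + g\<close>
  with \<open>g\<close> orthogonal to all \<open>\<phi>\<^sub>j\<close>. Then \<open>\<langle>T f, f\<rangle> = \<Sum>\<^sub>j \<lambda>\<^sub>j |\<langle>f, \<phi>\<^sub>j\<rangle>|\<^sup>2 + \<langle>T g, g\<rangle>\<close>, and the
  last term lies between \<open>a \<parallel>g\<parallel>\<^sup>2\<close> and \<open>b \<parallel>g\<parallel>\<^sup>2\<close> (\<open>dominant_numerical_range\<close>). Summed over the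
  \<open>e\<^sub>i\<close>, with \<open>\<rho>\<^sub>j = \<Sum>\<^sub>i |\<langle>\<phi>\<^sub>j, e\<^sub>i\<rangle>|\<^sup>2\<close>, this puts the trace between
  \<open>\<Sum>\<^sub>j \<rho>\<^sub>j \<lambda>\<^sub>j + a \<Sum>\<^sub>j (1 - \<rho>\<^sub>j)\<close> and the same expression with \<open>b\<close> for \<open>a\<close>. Here \<open>\<rho>\<^sub>1 = 1\<close>,
  because the constant function lies in the span of the indicators, and the upper expression is at
  most \<open>\<Sum>\<^sub>j \<lambda>\<^sub>j\<close>, because \<open>\<rho>\<^sub>j \<le> 1\<close> and \<open>b \<le> \<lambda>\<^sub>j\<close> (\<open>selfadjoint_metastability_bounds\<close>).

  The analytic core is the passage from the spectrum to the numerical range, done here without the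
  spectral theorem. If an interval \<open>(c, d)\<close> is free of spectrum, then \<open>(T - c)(T - d)\<close> is
  positive (\<open>spectral_gap_inequality\<close>); the intervals \<open>(c, a)\<close> with \<open>c \<rightarrow> -\<infinity>\<close> give the lower
  bound \<open>a\<close>. On the orthogonal complement of the \<open>\<phi>\<^sub>j\<close> the upper bound starts at \<open>1\<close> and
  is lowered from one eigenvalue to the next, and finally to \<open>b\<close>: each gap below the current
  bound \<open>d\<close> lets it drop to the other end of the gap, since \<open>d\<close> has no eigenvector left there
  (\<open>isolated_top_descent\<close>). This last step needs the completeness of \<open>L\<^sup>2\<close>
  (\<open>L2_fast_Cauchy_convergent\<close>).
\<close>

section \<open>Symmetric operators and spectral gaps\<close>

text \<open>
  A real vector space with a positive semidefinite form, carried by a set. The functions in \<open>L\<^sup>2\<close>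
  form such a space, with null functions as the vectors of length zero; so does any subspace. The linear
  combination \<open>lc c f d g\<close> stands for \<open>c f + d g\<close>, and vectors are compared only through the form
  \<open>ip\<close>, which identifies functions that agree almost everywhere. The real part of a complex inner product
  suffices as \<open>ip\<close>, because all scalars that occur are real.
\<close>

locale semi_inner_space =
  fixes V :: "'v set"
    and lc :: "real \<Rightarrow> 'v \<Rightarrow> real \<Rightarrow> 'v \<Rightarrow> 'v"
    and ip :: "'v \<Rightarrow> 'v \<Rightarrow> real"
  assumes lc_closed [simp, intro]: "f \<in> V \<Longrightarrow> g \<in> V \<Longrightarrow> lc c f d g \<in> V"
    and ip_sym: "f \<in> V \<Longrightarrow> g \<in> V \<Longrightarrow> ip f g = ip g f"
    and ip_lc_left [simp]:
      "f \<in> V \<Longrightarrow> g \<in> V \<Longrightarrow> h \<in> V \<Longrightarrow> ip (lc c f d g) h = c * ip f h + d * ip g h"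
    and ip_nonneg [simp]: "f \<in> V \<Longrightarrow> 0 \<le> ip f f"
begin

lemma ip_lc_right [simp]:
  "f \<in> V \<Longrightarrow> g \<in> V \<Longrightarrow> h \<in> V \<Longrightarrow> ip h (lc c f d g) = c * ip h f + d * ip h g"
  using ip_lc_left[of f g h c d] ip_sym by (metis lc_closed)

lemma ip_lc_square:
  assumes "f \<in> V" "g \<in> V"
  shows "ip (lc c f d g) (lc c f d g) = c\<^sup>2 * ip f f + 2 * c * d * ip f g + d\<^sup>2 * ip g g"
  using assms ip_sym[of g f] by (simp add: algebra_simps power2_eq_square)

lemma Cauchy_Schwarz:
  assumes f: "f \<in> V" and g: "g \<in> V"
  shows "\<bar>ip f g\<bar> \<le> sqrt (ip f f) * sqrt (ip g g)"
proof -
  have q: "0 \<le> c\<^sup>2 * ip f f + 2 * c * d * ip f g + d\<^sup>2 * ip g g" for c d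
    using ip_lc_square[OF f g, of c d] ip_nonneg[of "lc c f d g"] f g by simp
  have "(ip f g)\<^sup>2 \<le> ip f f * ip g g"
  proof (cases "ip g g = 0")
    case True
    have "0 \<le> ip f f + 2 * d * ip f g" for d using q[of 1 d] True by simp
    \<comment> \<open>a \<open>d\<close> at which the affine function takes the value \<open>-1\<close> unless \<open>ip f g = 0\<close>\<close>
    from this[of "- (ip f f + 1) / (2 * ip f g)"] have "ip f g = 0"
      by (cases "ip f g = 0") (auto simp: field_simps)
    then show ?thesis using True by simp
  next
    case False
    then have "ip g g > 0" using ip_nonneg[OF g] by simp
    have "0 \<le> ip g g * (ip f f * ip g g - (ip f g)\<^sup>2)"
      \<comment> \<open>the squared length of \<open>\<langle>g, g\<rangle> f - \<langle>f, g\<rangle> g\<close>\<close>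
      using q[of "ip g g" "- ip f g"] by (simp add: algebra_simps power2_eq_square)
    then show ?thesis using \<open>ip g g > 0\<close> by (simp add: zero_le_mult_iff)
  qed
  then show ?thesis
    by (metis real_sqrt_abs real_sqrt_le_mono real_sqrt_mult)
qed

lemma norm_triangle:
  assumes f: "f \<in> V" and g: "g \<in> V"
  shows "sqrt (ip (lc 1 f 1 g) (lc 1 f 1 g)) \<le> sqrt (ip f f) + sqrt (ip g g)"
proof (rule real_le_lsqrt)
  show "0 \<le> sqrt (ip f f) + sqrt (ip g g)" using f g by simp
  have "ip f g \<le> sqrt (ip f f) * sqrt (ip g g)" using Cauchy_Schwarz[OF f g] by linarith
  then show "ip (lc 1 f 1 g) (lc 1 f 1 g) \<le> (sqrt (ip f f) + sqrt (ip g g))\<^sup>2"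
    using f g unfolding ip_lc_square[OF f g] by (simp add: power2_sum)
qed

lemma norm_add_square_le:
  assumes f: "f \<in> V" and g: "g \<in> V"
  shows "ip (lc 1 f 1 g) (lc 1 f 1 g) \<le> 2 * ip f f + 2 * ip g g"
  using ip_nonneg[of "lc 1 f (-1) g"] f g
  unfolding ip_lc_square[OF f g] by (simp add: ip_sym[OF g f])

text \<open>
  Geometrically small steps make a Cauchy sequence: the triangle inequality over the steps from \<open>k\<close>
  to \<open>k + m\<close> gives a geometric series.
\<close>

lemma norm_telescope_le:
  assumes F: "\<And>k. F k \<in> V"
    and step: "\<And>k. sqrt (ip (lc 1 (F (Suc k)) (-1) (F k)) (lc 1 (F (Suc k)) (-1) (F k))) \<le> B * s ^ k"
    and "0 \<le> s" "s < 1" "0 \<le> B"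
  shows "sqrt (ip (lc 1 (F (k + m)) (-1) (F k)) (lc 1 (F (k + m)) (-1) (F k))) \<le> B * s ^ k / (1 - s)"
proof -
  have "sqrt (ip (lc 1 (F (k + m)) (-1) (F k)) (lc 1 (F (k + m)) (-1) (F k)))
    \<le> (\<Sum>i<m. B * s ^ (k + i))"
  proof (induction m)
    case 0
    then show ?case using F[of k] by simp
  next
    case (Suc m)
    let ?x = "lc 1 (F (k + m)) (-1) (F k)"
    let ?y = "lc 1 (F (Suc (k + m))) (-1) (F (k + m))"
    let ?z = "lc 1 (F (Suc (k + m))) (-1) (F k)"
    have "ip ?z ?z = ip (lc 1 ?x 1 ?y) (lc 1 ?x 1 ?y)"
      using F[of k] F[of "k + m"] F[of "Suc (k + m)"] by (simp add: ip_sym)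
    then have "sqrt (ip ?z ?z) \<le> sqrt (ip ?x ?x) + sqrt (ip ?y ?y)"
      using norm_triangle[of ?x ?y] F by (simp only: lc_closed)
    also have "\<dots> \<le> (\<Sum>i<m. B * s ^ (k + i)) + B * s ^ (k + m)"
      using Suc.IH step[of "k + m"] by (rule add_mono)
    finally show ?case by (simp only: add_Suc_right sum.lessThan_Suc)
  qed
  also have "\<dots> = B * s ^ k * (\<Sum>i<m. s ^ i)"
    by (simp add: sum_distrib_left power_add mult.assoc)
  also have "\<dots> \<le> B * s ^ k * (1 / (1 - s))"
  proof (rule mult_left_mono)
    have "(\<Sum>i<m. s ^ i) = (1 - s ^ m) / (1 - s)"
      using \<open>s < 1\<close> by (simp add: sum_gp_strict)
    also have "\<dots> \<le> 1 / (1 - s)"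
      using \<open>s < 1\<close> \<open>0 \<le> s\<close> by (intro divide_right_mono) auto
    finally show "(\<Sum>i<m. s ^ i) \<le> 1 / (1 - s)" .
  qed (use assms in simp)
  finally show ?thesis by simp
qed

definition symmetric_op :: "('v \<Rightarrow> 'v) \<Rightarrow> bool" where
  "symmetric_op U \<longleftrightarrow> (\<forall>f\<in>V. U f \<in> V) \<and> (\<forall>f\<in>V. \<forall>g\<in>V. ip (U f) g = ip f (U g))"

lemma symmetric_op_closed: "symmetric_op U \<Longrightarrow> f \<in> V \<Longrightarrow> U f \<in> V"
  by (simp add: symmetric_op_def)

lemma symmetric_opD: "symmetric_op U \<Longrightarrow> f \<in> V \<Longrightarrow> g \<in> V \<Longrightarrow> ip (U f) g = ip f (U g)"
  by (simp add: symmetric_op_def)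

text \<open>
  Linearity, seen through the form, is a consequence of symmetry: move the operator to the other
  argument, expand, and move it back.
\<close>

lemma symmetric_op_lc:
  assumes U: "symmetric_op U" and f: "f \<in> V" and g: "g \<in> V" and h: "h \<in> V"
  shows "ip (U (lc c f d g)) h = c * ip (U f) h + d * ip (U g) h"
    and "ip h (U (lc c f d g)) = c * ip h (U f) + d * ip h (U g)"
proof -
  note cl = symmetric_op_closed[OF U]
  show "ip (U (lc c f d g)) h = c * ip (U f) h + d * ip (U g) h"
    using symmetric_opD[OF U] cl f g h by simp
  then show "ip h (U (lc c f d g)) = c * ip h (U f) + d * ip h (U g)"
    using ip_sym[OF h] cl f g by simp
qed

text \<open>
  A positive operator \<open>W \<le> K\<close> satisfies \<open>W\<^sup>2 \<le> K W\<close>. The reason is positivity of \<open>W\<close> at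
  \<open>f - W f / K\<close>. In particular, \<open>\<langle>W f, f\<rangle>\<close> controls \<open>\<parallel>W f\<parallel>\<close>, so that almost minimisers of the
  form are almost null vectors of \<open>W\<close>.
\<close>

lemma positive_op_bound:
  assumes W: "symmetric_op W" and K: "0 < K"
    and pos: "\<And>f. f \<in> V \<Longrightarrow> 0 \<le> ip (W f) f"
    and bd: "\<And>f. f \<in> V \<Longrightarrow> ip (W f) f \<le> K * ip f f"
    and f: "f \<in> V"
  shows "ip (W f) (W f) \<le> K * ip (W f) f"
proof -
  note cl = symmetric_op_closed[OF W]
  define h where "h = lc 1 f (- 1 / K) (W f)"
  have h: "h \<in> V" using f cl by (simp add: h_def)
  have "ip (W h) h = ip (W f) f - 2 / K * ip (W f) (W f) + 1 / K\<^sup>2 * ip (W (W f)) (W f)"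
    using f cl symmetric_opD[OF W, of "W f" f] unfolding h_def
    by (simp add: symmetric_op_lc[OF W] algebra_simps power2_eq_square)
  also have "1 / K\<^sup>2 * ip (W (W f)) (W f) \<le> 1 / K\<^sup>2 * (K * ip (W f) (W f))"
    using bd[of "W f"] f cl K by (intro mult_left_mono) auto
  finally have "0 \<le> ip (W f) f - 1 / K * ip (W f) (W f)"
    using pos[OF h] K by (simp add: power2_eq_square)
  then show ?thesis using K by (simp add: field_simps)
qed

text \<open>
  Let \<open>q\<close> be the infimum of \<open>\<parallel>U f\<parallel>\<^sup>2 / \<parallel>f\<parallel>\<^sup>2\<close> and suppose that \<open>q < r\<^sup>2\<close>. Then \<open>W = U\<^sup>2 - q\<close> is
  positive and factors as \<open>(U - \<surd>q)(U + \<surd>q)\<close> with both factors bounded below. Hence \<open>W\<close> is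
  bounded below, and since \<open>\<parallel>W f\<parallel>\<^sup>2\<close> is at most a multiple of \<open>\<langle>W f, f\<rangle>\<close>, the infimum \<open>q\<close> could be
  raised.
\<close>

lemma symmetric_op_gap:
  assumes U: "symmetric_op U"
    and bd: "\<And>f. f \<in> V \<Longrightarrow> ip (U f) (U f) \<le> K * ip f f"
    and below: "\<And>t. \<bar>t\<bar> < r \<Longrightarrow>
      \<exists>C. \<forall>f\<in>V. ip f f \<le> C * ip (lc 1 (U f) (- t) f) (lc 1 (U f) (- t) f)"
    and f: "f \<in> V" and r: "0 < r"
  shows "r\<^sup>2 * ip f f \<le> ip (U f) (U f)"
proof (rule ccontr)
  note cl = symmetric_op_closed[OF U]
  assume "\<not> ?thesis"
  then have less: "ip (U f) (U f) < r\<^sup>2 * ip f f" by simp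
  then have "0 < r\<^sup>2 * ip f f"
    using ip_nonneg[OF cl[OF f]] by linarith
  then have fpos: "ip f f > 0" using r by (simp add: zero_less_mult_iff)
  define S where "S = {ip (U g) (U g) / ip g g |g. g \<in> V \<and> 0 < ip g g}"
  define q where "q = Inf S"
  have S0: "x \<ge> 0" if "x \<in> S" for x using that by (auto simp: S_def cl)
  then have bdd: "bdd_below S" by (meson bdd_below.I)
  have inS: "ip (U f) (U f) / ip f f \<in> S" using f fpos by (auto simp: S_def)
  have "q \<ge> 0" unfolding q_def using inS S0 by (intro cInf_greatest) auto
  have "q \<le> ip (U f) (U f) / ip f f" unfolding q_def using inS bdd by (rule cInf_lower)
  also have "\<dots> < r\<^sup>2" using less fpos by (simp add: field_simps)
  finally have "q < r\<^sup>2" .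
  have qle: "q * ip g g \<le> ip (U g) (U g)" if g: "g \<in> V" for g
  proof (cases "ip g g = 0")
    case True
    then show ?thesis using g cl by simp
  next
    case False
    then have p: "ip g g > 0" using ip_nonneg[OF g] by simp
    then have "q \<le> ip (U g) (U g) / ip g g"
      unfolding q_def using g bdd by (intro cInf_lower) (auto simp: S_def)
    then show ?thesis using p by (simp add: field_simps)
  qed
  define W where "W g = lc 1 (U (U g)) (- q) g" for g
  have W: "symmetric_op W"
    unfolding symmetric_op_def W_def using cl symmetric_opD[OF U] by simp
  have Wip: "ip (W g) g = ip (U g) (U g) - q * ip g g" if "g \<in> V" for g
    using that cl symmetric_opD[OF U, of "U g" g] by (simp add: W_def)
  define L where "L = max K 1"
  have L: "L > 0" by (simp add: L_def)
  have Wbd: "ip (W g) (W g) \<le> L * ip (W g) g" if g: "g \<in> V" for g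
  proof (rule positive_op_bound[OF W L _ _ g])
    fix h assume h: "h \<in> V"
    show "0 \<le> ip (W h) h" using qle[OF h] Wip[OF h] by simp
    have "K * ip h h \<le> L * ip h h" using h by (intro mult_right_mono) (auto simp: L_def)
    moreover have "0 \<le> q * ip h h" using h \<open>q \<ge> 0\<close> by simp
    ultimately show "ip (W h) h \<le> L * ip h h" using bd[OF h] Wip[OF h] by simp
  qed
  define t where "t = sqrt q"
  have tq: "t * t = q" using \<open>q \<ge> 0\<close> by (simp add: t_def)
  have "\<bar>t\<bar> < r"
    using \<open>q < r\<^sup>2\<close> \<open>q \<ge> 0\<close> r real_less_lsqrt by (simp add: t_def)
  then obtain C1 C2 where
    C1: "\<And>g. g \<in> V \<Longrightarrow> ip g g \<le> C1 * ip (lc 1 (U g) (- t) g) (lc 1 (U g) (- t) g)" and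
    C2: "\<And>g. g \<in> V \<Longrightarrow> ip g g \<le> C2 * ip (lc 1 (U g) t g) (lc 1 (U g) t g)"
    using below[of t] below[of "- t"] by auto
  define D where "D = max C1 1 * max C2 1 * L"
  have D: "D > 0" using L by (simp add: D_def)
  have key: "ip g g \<le> D * (ip (U g) (U g) - q * ip g g)" if g: "g \<in> V" for g
  proof -
    define h where "h = lc 1 (U g) t g"
    have h: "h \<in> V" using g cl by (simp add: h_def)
    have eq: "ip (lc 1 (U h) (- t) h) (lc 1 (U h) (- t) h) = ip (W g) (W g)"
      using g cl ip_sym[of "U g" "U (U g)"] ip_sym[of g "U (U g)"] ip_sym[of g "U g"]
      by (simp add: h_def W_def symmetric_op_lc[OF U] tq[symmetric] algebra_simps)
    have "ip g g \<le> C2 * ip h h" using C2[OF g] by (simp add: h_def)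
    also have "\<dots> \<le> max C2 1 * ip h h" using h by (intro mult_right_mono) auto
    also have "\<dots> \<le> max C2 1 * (C1 * ip (W g) (W g))"
      using C1[OF h] eq by (intro mult_left_mono) auto
    also have "\<dots> \<le> max C2 1 * (max C1 1 * ip (W g) (W g))"
      using g symmetric_op_closed[OF W] by (intro mult_left_mono mult_right_mono) auto
    also have "\<dots> \<le> max C2 1 * (max C1 1 * (L * ip (W g) g))"
      using Wbd[OF g] by (intro mult_left_mono) auto
    finally show ?thesis using Wip[OF g] by (simp add: D_def mult_ac)
  qed
  \<comment> \<open>by \<open>key\<close>, every quotient in \<open>S\<close> is at least \<open>q + 1 / D\<close>\<close>
  have "q + 1 / D \<le> q"
    unfolding q_def
  proof (rule cInf_greatest)
    show "S \<noteq> {}" using inS by auto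
    fix x assume "x \<in> S"
    then obtain g where g: "g \<in> V" "0 < ip g g" and x: "x = ip (U g) (U g) / ip g g"
      by (auto simp: S_def)
    show "Inf S + 1 / D \<le> x"
      using key[OF g(1)] g(2) D unfolding x q_def[symmetric] by (simp add: field_simps)
  qed
  then show False using D by simp
qed

text \<open>
  Completeness is only stated for sequences whose steps decay geometrically, and convergence is
  convergence in the seminorm, so that the limit is unique only up to vectors of length zero.
\<close>

definition geometrically_complete :: bool where
  "geometrically_complete \<longleftrightarrow> (\<forall>F B s. (\<forall>k. F k \<in> V) \<longrightarrow> 0 \<le> s \<longrightarrow> s < 1 \<longrightarrow> 0 \<le> B \<longrightarrow>
     (\<forall>k. sqrt (ip (lc 1 (F (Suc k)) (-1) (F k)) (lc 1 (F (Suc k)) (-1) (F k))) \<le> B * s ^ k) \<longrightarrow>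
     (\<exists>w\<in>V. (\<lambda>k. ip (lc 1 (F k) (-1) w) (lc 1 (F k) (-1) w)) \<longlonglongrightarrow> 0))"

text \<open>
  The hypothesis \<open>u\<^sup>2 \<ge> \<delta> u\<close> says that the spectrum of \<open>u\<close> avoids \<open>(0, \<delta>)\<close>; without a kernel, \<open>u\<close>
  must be at least \<open>\<delta>\<close>. On the range of \<open>u\<close> this is algebra: \<open>u\<^sup>3 \<ge> \<delta> u\<^sup>2\<close> follows from positivity
  of \<open>u\<close> at \<open>u g - \<delta> g\<close>. To reach every \<open>f\<close>, iterate \<open>F\<^sub>k = (1 - u/K)\<^sup>k f\<close>. Then \<open>\<langle>u F\<^sub>k, F\<^sub>k\<rangle>\<close>
  decays geometrically, so \<open>F\<^sub>k\<close> converges, and its limit lies in the kernel of \<open>u\<close>. Thus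
  \<open>F\<^sub>k \<rightarrow> 0\<close>; but \<open>f - F\<^sub>k = u G\<^sub>k\<close> lies in the range, and the inequality passes to the limit.
\<close>

lemma positive_op_coercive:
  assumes complete: geometrically_complete
    and u: "symmetric_op u"
    and pos: "\<And>f. f \<in> V \<Longrightarrow> 0 \<le> ip (u f) f"
    and bd0: "\<And>f. f \<in> V \<Longrightarrow> ip (u f) f \<le> K0 * ip f f"
    and gap: "\<And>f. f \<in> V \<Longrightarrow> \<delta> * ip (u f) f \<le> ip (u f) (u f)"
    and \<delta>: "0 < \<delta>"
    and inj: "\<And>w. w \<in> V \<Longrightarrow> ip (u w) (u w) = 0 \<Longrightarrow> ip w w = 0"
    and f: "f \<in> V"
  shows "\<delta> * ip f f \<le> ip (u f) f"
proof -
  note cl = symmetric_op_closed[OF u]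
  \<comment> \<open>a bound that also dominates \<open>\<delta>\<close>, so that the contraction factor \<open>1 - \<delta> / K\<close> is nonnegative\<close>
  define K where "K = max K0 \<delta>"
  have K: "K > 0" "\<delta> \<le> K" using \<delta> by (auto simp: K_def)
  have bd: "ip (u g) g \<le> K * ip g g" if g: "g \<in> V" for g
  proof -
    have "K0 * ip g g \<le> K * ip g g" using g by (intro mult_right_mono) (auto simp: K_def)
    then show ?thesis using bd0[OF g] by simp
  qed
  note ubd = positive_op_bound[OF u K(1) pos bd]
  define F where "F k = ((\<lambda>g. lc 1 g (- 1 / K) (u g)) ^^ k) f" for k :: nat
  have F0: "F 0 = f" and FS: "F (Suc k) = lc 1 (F k) (- 1 / K) (u (F k))" for k
    by (simp_all add: F_def)
  have F: "F k \<in> V" for k by (induction k) (simp_all add: F0 FS f cl)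
  define q where "q = 1 - \<delta> / K"
  have q: "0 \<le> q" "q < 1" using K \<delta> by (auto simp: q_def)
  define e where "e k = ip (u (F k)) (F k)" for k
  have e0: "0 \<le> e k" for k using pos[OF F] by (simp add: e_def)
  have eS: "e (Suc k) \<le> q * e k" for k
  proof -
    let ?g = "F k"
    have g: "?g \<in> V" "u ?g \<in> V" "u (u ?g) \<in> V" using F cl by auto
    have "e (Suc k) = e k - 2 / K * ip (u ?g) (u ?g) + 1 / K\<^sup>2 * ip (u (u ?g)) (u ?g)"
      using g symmetric_opD[OF u, of "u ?g" ?g] unfolding e_def FS
      by (simp add: symmetric_op_lc[OF u] algebra_simps power2_eq_square)
    also have "1 / K\<^sup>2 * ip (u (u ?g)) (u ?g) \<le> 1 / K\<^sup>2 * (K * ip (u ?g) (u ?g))"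
      using bd[of "u ?g"] g by (intro mult_left_mono) auto
    finally have "e (Suc k) \<le> e k - 1 / K * ip (u ?g) (u ?g)"
      using K by (simp add: power2_eq_square)
    also have "\<dots> \<le> e k - 1 / K * (\<delta> * e k)"
      using gap[OF g(1)] K unfolding e_def by (intro diff_left_mono mult_left_mono) auto
    finally show ?thesis by (simp add: q_def algebra_simps)
  qed
  have ek: "e k \<le> q ^ k * e 0" for k
  proof (induction k)
    case (Suc k)
    have "e (Suc k) \<le> q * (q ^ k * e 0)"
      using eS[of k] mult_left_mono[OF Suc.IH q(1)] by simp
    then show ?case by simp
  qed simp
  have lim_e: "e \<longlonglongrightarrow> 0"
  proof (rule tendsto_sandwich[where f = "\<lambda>_. 0" and h = "\<lambda>k. q ^ k * e 0"])
    show "(\<lambda>k. q ^ k * e 0) \<longlonglongrightarrow> 0"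
      using q by (intro tendsto_mult_left_zero LIMSEQ_realpow_zero) auto
  qed (use e0 ek in auto)
  have "\<exists>w\<in>V. (\<lambda>k. ip (lc 1 (F k) (-1) w) (lc 1 (F k) (-1) w)) \<longlonglongrightarrow> 0"
  proof -
    have "sqrt (ip (lc 1 (F (Suc k)) (-1) (F k)) (lc 1 (F (Suc k)) (-1) (F k)))
       \<le> sqrt (e 0 / K) * sqrt q ^ k" for k
    proof -
      have "ip (lc 1 (F (Suc k)) (-1) (F k)) (lc 1 (F (Suc k)) (-1) (F k))
          = 1 / K\<^sup>2 * ip (u (F k)) (u (F k))"
        using F[of k] cl[OF F[of k]] by (simp add: FS algebra_simps power2_eq_square)
      also have "\<dots> \<le> 1 / K\<^sup>2 * (K * e k)"
        using ubd[OF _ _ F[of k]] by (intro mult_left_mono) (auto simp: e_def)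
      also have "\<dots> = e k / K" using K by (simp add: power2_eq_square)
      also have "\<dots> \<le> q ^ k * e 0 / K" using ek[of k] K by (simp add: divide_right_mono)
      finally have "sqrt (ip (lc 1 (F (Suc k)) (-1) (F k)) (lc 1 (F (Suc k)) (-1) (F k)))
        \<le> sqrt (e 0 / K * q ^ k)" by (simp add: mult.commute)
      also have "\<dots> = sqrt (e 0 / K) * sqrt q ^ k"
        by (simp only: real_sqrt_mult real_sqrt_power)
      finally show ?thesis .
    qed
    moreover have "0 \<le> sqrt q" "sqrt q < 1" "0 \<le> sqrt (e 0 / K)" using q e0[of 0] K by auto
    ultimately show ?thesis
      using complete F unfolding geometrically_complete_def by blast
  qed
  then obtain w where w: "w \<in> V"
    and lim_w: "(\<lambda>k. ip (lc 1 (F k) (-1) w) (lc 1 (F k) (-1) w)) \<longlonglongrightarrow> 0" by blast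
  have uw_le: "ip (u w) w \<le> 2 * e k + 2 * (K * ip (lc 1 (F k) (-1) w) (lc 1 (F k) (-1) w))" for k
  proof -
    \<comment> \<open>the parallelogram law for the form \<open>\<langle>u x, y\<rangle>\<close> at \<open>F k\<close> and \<open>F k - w\<close>\<close>
    let ?d = "lc 1 (F k) (-1) w" and ?s = "lc 2 (F k) (-1) w"
    have d: "?d \<in> V" "?s \<in> V" using F w by auto
    have "ip (u w) w + ip (u ?s) ?s = 2 * e k + 2 * ip (u ?d) ?d"
      using F[of k] w cl[OF w] cl[OF F[of k]] symmetric_opD[OF u w F[of k]]
        ip_sym[OF cl[OF F[of k]] w]
      by (simp add: symmetric_op_lc[OF u] e_def algebra_simps)
    then show ?thesis using pos[OF d(2)] bd[OF d(1)] by linarith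
  qed
  have "ip (u w) w \<le> 2 * 0 + 2 * (K * 0)"
  proof (rule LIMSEQ_le_const)
    show "(\<lambda>k. 2 * e k + 2 * (K * ip (lc 1 (F k) (-1) w) (lc 1 (F k) (-1) w)))
        \<longlonglongrightarrow> 2 * 0 + 2 * (K * 0)"
      by (intro tendsto_intros lim_e lim_w)
  qed (use uw_le in blast)
  then have "ip (u w) (u w) \<le> 0"
    using ubd[OF _ _ w] K by (smt (verit) mult_nonneg_nonpos)
  then have "ip (u w) (u w) = 0" using ip_nonneg[OF cl[OF w]] by (rule antisym)
  then have w0: "ip w w = 0" by (rule inj[OF w])
  have lim_F: "(\<lambda>k. ip (F k) (F k)) \<longlonglongrightarrow> 0"
  proof (rule tendsto_sandwich[where f = "\<lambda>_. 0"
        and h = "\<lambda>k. 2 * ip (lc 1 (F k) (-1) w) (lc 1 (F k) (-1) w) + 2 * ip w w"])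
    show "(\<lambda>k. 2 * ip (lc 1 (F k) (-1) w) (lc 1 (F k) (-1) w) + 2 * ip w w) \<longlonglongrightarrow> 0"
      unfolding w0 using lim_w by (auto intro!: tendsto_eq_intros)
    have "ip (F k) (F k) \<le> 2 * ip (lc 1 (F k) (-1) w) (lc 1 (F k) (-1) w) + 2 * ip w w" for k
      using norm_add_square_le[of "lc 1 (F k) (-1) w" w] F[of k] w by simp
    then show "\<forall>\<^sub>F k in sequentially.
        ip (F k) (F k) \<le> 2 * ip (lc 1 (F k) (-1) w) (lc 1 (F k) (-1) w) + 2 * ip w w" by simp
  qed (use F in auto)
  have weak: "(\<lambda>k. ip g (F k)) \<longlonglongrightarrow> 0" if g: "g \<in> V" for g
  proof (rule tendsto_rabs_zero_cancel, rule tendsto_sandwich[where f = "\<lambda>_. 0"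
        and h = "\<lambda>k. sqrt (ip g g) * sqrt (ip (F k) (F k))"])
    show "(\<lambda>k. sqrt (ip g g) * sqrt (ip (F k) (F k))) \<longlonglongrightarrow> 0"
      using tendsto_mult_right_zero[OF tendsto_real_sqrt[OF lim_F, unfolded real_sqrt_zero]] .
  qed (use Cauchy_Schwarz[OF g F] in auto)
  \<comment> \<open>\<open>G k\<close> is the sum of \<open>F i / K\<close> over \<open>i < k\<close>, so that \<open>u (G k) = f - F k\<close>\<close>
  define G where "G k = rec_nat (lc 0 f 0 f) (\<lambda>k g. lc 1 g (1 / K) (F k)) k" for k :: nat
  have G0: "G 0 = lc 0 f 0 f" and GS: "G (Suc k) = lc 1 (G k) (1 / K) (F k)" for k
    by (simp_all add: G_def)
  have G: "G k \<in> V" for k by (induction k) (simp_all add: G0 GS f F)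
  have uG: "ip (u (G k)) h = ip f h - ip (F k) h" if h: "h \<in> V" for k h
  proof (induction k)
    case 0
    then show ?case using f h by (simp add: G0 F0 symmetric_op_lc[OF u])
  next
    case (Suc k)
    then show ?case using F[of k] G[of k] h cl[OF F[of k]]
      by (simp add: GS FS symmetric_op_lc[OF u])
  qed
  have uG': "ip h (u (G k)) = ip h f - ip h (F k)" if h: "h \<in> V" for k h
    using uG[OF h, of k] ip_sym[OF h] cl G F f by simp
  have range: "\<delta> * ip (u (G k)) (u (G k)) \<le> ip (u (u (G k))) (u (G k))" for k
  proof -
    let ?g = "G k"
    have g: "?g \<in> V" "u ?g \<in> V" "u (u ?g) \<in> V" using G cl by auto
    have "0 \<le> ip (u (lc 1 (u ?g) (- \<delta>) ?g)) (lc 1 (u ?g) (- \<delta>) ?g)"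
      using pos g by simp
    also have "\<dots> = ip (u (u ?g)) (u ?g) - 2 * \<delta> * ip (u ?g) (u ?g) + \<delta> * (\<delta> * ip (u ?g) ?g)"
      using g symmetric_opD[OF u, of "u ?g" ?g]
      by (simp add: symmetric_op_lc[OF u] algebra_simps)
    also have "\<delta> * (\<delta> * ip (u ?g) ?g) \<le> \<delta> * ip (u ?g) (u ?g)"
      using gap[OF g(1)] \<delta> by (intro mult_left_mono) auto
    finally show ?thesis by simp
  qed
  have lhs: "ip (u (G k)) (u (G k)) = ip f f - 2 * ip f (F k) + ip (F k) (F k)" for k
    using G[of k] cl[OF G[of k]] f F[of k] by (simp add: uG uG' ip_sym[OF F[of k] f])
  have rhs: "ip (u (u (G k))) (u (G k)) = ip (u f) f - 2 * ip (u f) (F k) + e k" for k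
  proof -
    let ?v = "u (G k)"
    have v: "?v \<in> V" using G cl by simp
    have "ip (u ?v) ?v = ip ?v (u f) - ip ?v (u (F k))"
      using uG'[OF cl[OF v], of k] symmetric_opD[OF u v f] symmetric_opD[OF u v F[of k]] by simp
    also have "\<dots> = ip f (u f) - ip (F k) (u f) - (ip f (u (F k)) - ip (F k) (u (F k)))"
      using uG[OF cl[OF f], of k] uG[OF cl[OF F], of k k] by simp
    also have "\<dots> = ip (u f) f - 2 * ip (u f) (F k) + e k"
      using ip_sym[OF f cl[OF f]] ip_sym[OF F[of k] cl[OF f]] symmetric_opD[OF u f F[of k]]
        ip_sym[OF F[of k] cl[OF F[of k]]] by (simp add: e_def)
    finally show ?thesis .
  qed
  show ?thesis
  proof (rule LIMSEQ_le[where X = "\<lambda>k. \<delta> * (ip f f - 2 * ip f (F k) + ip (F k) (F k))"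
        and Y = "\<lambda>k. ip (u f) f - 2 * ip (u f) (F k) + e k"])
    show "(\<lambda>k. \<delta> * (ip f f - 2 * ip f (F k) + ip (F k) (F k))) \<longlonglongrightarrow> \<delta> * ip f f"
      using weak[OF f] lim_F by (auto intro!: tendsto_eq_intros)
    show "(\<lambda>k. ip (u f) f - 2 * ip (u f) (F k) + e k) \<longlonglongrightarrow> ip (u f) f"
      using weak[OF cl[OF f]] lim_e by (auto intro!: tendsto_eq_intros)
  qed (use range lhs rhs in auto)
qed

text \<open>
  The bound \<open>\<parallel>(T - s) f\<parallel> \<ge> r \<parallel>f\<parallel>\<close> about the midpoint \<open>s\<close> of \<open>(c, d)\<close>, with \<open>r\<close> half its length, is
  the positivity of \<open>(T - s)\<^sup>2 - r\<^sup>2 = (T - c)(T - d)\<close>.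
\<close>

lemma spectral_gap_inequality:
  assumes T: "symmetric_op T"
    and bd: "\<And>f. f \<in> V \<Longrightarrow> ip (T f) (T f) \<le> K * ip f f"
    and cd: "c < d"
    and below: "\<And>z. c < z \<Longrightarrow> z < d \<Longrightarrow>
      \<exists>C. \<forall>f\<in>V. ip f f \<le> C * ip (lc 1 (T f) (- z) f) (lc 1 (T f) (- z) f)"
    and f: "f \<in> V"
  shows "0 \<le> ip (T f) (T f) - (c + d) * ip (T f) f + c * d * ip f f"
proof -
  note cl = symmetric_op_closed[OF T]
  define s where "s = (c + d) / 2"
  define U where "U g = lc 1 (T g) (- s) g" for g
  have U: "symmetric_op U"
    unfolding symmetric_op_def U_def using symmetric_opD[OF T] by (simp add: cl)
  have "((d - c) / 2)\<^sup>2 * ip f f \<le> ip (U f) (U f)"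
  proof (rule symmetric_op_gap[OF U _ _ f])
    fix g assume g: "g \<in> V"
    have "ip (U g) (U g) \<le> 2 * ip (T g) (T g) + 2 * (s\<^sup>2 * ip g g)"
      using norm_add_square_le[of "T g" "lc 0 g (- s) g"] g cl[OF g]
      by (simp add: U_def algebra_simps power2_eq_square)
    then show "ip (U g) (U g) \<le> (2 * K + 2 * s\<^sup>2) * ip g g"
      using bd[OF g] by (simp add: algebra_simps)
  next
    fix t :: real assume t: "\<bar>t\<bar> < (d - c) / 2"
    then have "c < s + t" "s + t < d" by (auto simp: s_def field_simps)
    then obtain C where C: "\<forall>f\<in>V. ip f f \<le> C * ip (lc 1 (T f) (- (s + t)) f) (lc 1 (T f) (- (s + t)) f)"
      using below by blast
    have "ip (lc 1 (U g) (- t) g) (lc 1 (U g) (- t) g)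
        = ip (lc 1 (T g) (- (s + t)) g) (lc 1 (T g) (- (s + t)) g)" if g: "g \<in> V" for g
      using g cl[OF g] by (simp add: U_def algebra_simps)
    then show "\<exists>C. \<forall>f\<in>V. ip f f \<le> C * ip (lc 1 (U f) (- t) f) (lc 1 (U f) (- t) f)"
      using C by auto
  qed (use cd in simp)
  also have "ip (U f) (U f) = ip (T f) (T f) - (c + d) * ip (T f) f + s\<^sup>2 * ip f f"
  proof -
    have "c + d = 2 * s" by (simp add: s_def)
    then show ?thesis
      using f cl[OF f] ip_sym[OF f cl[OF f]]
      by (simp add: U_def algebra_simps power2_eq_square)
  qed
  finally show ?thesis by (simp add: s_def field_simps power2_eq_square)
qed

text \<open>
  The form \<open>\<langle>(T - c)(T - a) f, f\<rangle>\<close> is affine in \<open>c\<close> with slope \<open>-\<langle>(T - a) f, f\<rangle>\<close>; it could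
  not stay nonnegative as \<open>c \<rightarrow> -\<infinity>\<close> if \<open>\<langle>(T - a) f, f\<rangle>\<close> were negative.
\<close>

lemma numerical_range_ge:
  assumes T: "symmetric_op T"
    and gap: "\<And>c. c < a \<Longrightarrow> 0 \<le> ip (T f) (T f) - (c + a) * ip (T f) f + c * a * ip f f"
    and f: "f \<in> V"
  shows "a * ip f f \<le> ip (T f) f"
proof (rule ccontr)
  assume less: "\<not> ?thesis"
  define \<epsilon> where "\<epsilon> = a * ip f f - ip (T f) f"
  have \<epsilon>: "\<epsilon> > 0" using less by (simp add: \<epsilon>_def)
  define x where "x = ip (T f) (T f) - a * ip (T f) f"
  have neg: "0 \<le> x + c * \<epsilon>" if "c < a" for c
    using gap[OF that] by (simp add: x_def \<epsilon>_def algebra_simps)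
  \<comment> \<open>far enough to the left that \<open>c * \<epsilon>\<close> outweighs \<open>x\<close>\<close>
  define c where "c = min (a - 1) (- (\<bar>x\<bar> + 1) / \<epsilon>)"
  have "c * \<epsilon> \<le> - (\<bar>x\<bar> + 1) / \<epsilon> * \<epsilon>"
    using \<epsilon> by (intro mult_right_mono) (auto simp: c_def)
  then have "c * \<epsilon> \<le> - (\<bar>x\<bar> + 1)" using \<epsilon> by simp
  moreover have "0 \<le> x + c * \<epsilon>" by (rule neg) (simp add: c_def)
  ultimately show False by linarith
qed

text \<open>
  For \<open>u = d - T \<ge> 0\<close> the gap inequality reads \<open>u\<^sup>2 \<ge> (d - c) u\<close>, and \<open>u\<close> has no kernel because \<open>d\<close>
  is not an eigenvalue; so \<open>u \<ge> d - c\<close>.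
\<close>

lemma isolated_top_descent:
  assumes complete: geometrically_complete
    and T: "symmetric_op T"
    and bd: "\<And>f. f \<in> V \<Longrightarrow> ip (T f) (T f) \<le> K * ip f f"
    and cd: "c < d"
    and gap: "\<And>f. f \<in> V \<Longrightarrow> 0 \<le> ip (T f) (T f) - (c + d) * ip (T f) f + c * d * ip f f"
    and top: "\<And>f. f \<in> V \<Longrightarrow> ip (T f) f \<le> d * ip f f"
    and inj: "\<And>w. w \<in> V \<Longrightarrow> ip (lc 1 (T w) (- d) w) (lc 1 (T w) (- d) w) = 0 \<Longrightarrow> ip w w = 0"
    and f: "f \<in> V"
  shows "ip (T f) f \<le> c * ip f f"
proof -
  note cl = symmetric_op_closed[OF T]
  define u where "u g = lc d g (-1) (T g)" for g
  have u: "symmetric_op u"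
    unfolding symmetric_op_def u_def using symmetric_opD[OF T] by (simp add: cl)
  have uip: "ip (u g) g = d * ip g g - ip (T g) g" if "g \<in> V" for g
    using that cl[OF that] by (simp add: u_def)
  have uu: "ip (u g) (u g) = ip (T g) (T g) - 2 * d * ip (T g) g + d\<^sup>2 * ip g g" if g: "g \<in> V" for g
    using g cl[OF g] ip_sym[OF g cl[OF g]] by (simp add: u_def algebra_simps power2_eq_square)
  have "(d - c) * ip f f \<le> ip (u f) f"
  proof (rule positive_op_coercive[OF complete u _ _ _ _ _ f])
    fix g assume g: "g \<in> V"
    show "0 \<le> ip (u g) g" using top[OF g] uip[OF g] by simp
    \<comment> \<open>bounds \<open>-\<langle>T g, g\<rangle>\<close> by \<open>(\<parallel>T g\<parallel>\<^sup>2 + \<parallel>g\<parallel>\<^sup>2) / 2\<close>\<close>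
    have "0 \<le> ip (lc 1 (T g) 1 g) (lc 1 (T g) 1 g)"
      by (intro ip_nonneg lc_closed g cl)
    then have "0 \<le> ip (T g) (T g) + 2 * ip (T g) g + ip g g"
      using g cl[OF g] ip_sym[OF g cl[OF g]] by simp
    then have "ip (u g) g \<le> d * ip g g + (K * ip g g + ip g g) / 2"
      using bd[OF g] uip[OF g] by argo
    then show "ip (u g) g \<le> (d + (K + 1) / 2) * ip g g"
      by (simp add: algebra_simps)
    show "(d - c) * ip (u g) g \<le> ip (u g) (u g)"
      using gap[OF g] unfolding uip[OF g] uu[OF g] by (simp add: algebra_simps power2_eq_square)
  next
    fix w assume w: "w \<in> V" and "ip (u w) (u w) = 0"
    moreover have "ip (lc 1 (T w) (- d) w) (lc 1 (T w) (- d) w) = ip (u w) (u w)"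
      using w cl[OF w] by (simp add: u_def algebra_simps)
    ultimately show "ip w w = 0" using inj[OF w] by simp
  qed (use cd in simp)
  then show ?thesis by (simp add: uip[OF f] algebra_simps)
qed

end

section \<open>Inner products and completeness of square-integrable functions\<close>

definition real_lc :: "real \<Rightarrow> ('a \<Rightarrow> complex) \<Rightarrow> real \<Rightarrow> ('a \<Rightarrow> complex) \<Rightarrow> 'a \<Rightarrow> complex" where
  "real_lc c f d g = (\<lambda>x. of_real c * f x + of_real d * g x)"

definition Re_inner :: "'a measure \<Rightarrow> ('a \<Rightarrow> complex) \<Rightarrow> ('a \<Rightarrow> complex) \<Rightarrow> real" where
  "Re_inner \<pi> f g = Re (L2_inner \<pi> f g)"

lemma borel_measurable_cnj [measurable (raw)]:
  fixes f :: "'a \<Rightarrow> complex"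
  shows "f \<in> borel_measurable M \<Longrightarrow> (\<lambda>x. cnj (f x)) \<in> borel_measurable M"
  by (rule borel_measurable_continuous_on[of cnj]) (auto intro: continuous_intros)

lemma L2_measurable [measurable_dest]: "f \<in> L2 M \<Longrightarrow> f \<in> borel_measurable M"
  by (simp add: L2_def)

lemma L2_integrable_square: "f \<in> L2 M \<Longrightarrow> integrable M (\<lambda>x. (cmod (f x))\<^sup>2)"
  by (simp add: L2_def)

lemma L2_add [intro]:
  assumes [measurable]: "f \<in> L2 M" "g \<in> L2 M"
  shows "(\<lambda>x. f x + g x) \<in> L2 M"
proof -
  have "integrable M (\<lambda>x. (cmod (f x + g x))\<^sup>2)"
  proof (rule Bochner_Integration.integrable_bound)
    show "integrable M (\<lambda>x. 2 * (cmod (f x))\<^sup>2 + 2 * (cmod (g x))\<^sup>2)"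
      using assms by (intro Bochner_Integration.integrable_add integrable_mult_right L2_integrable_square)
    have "(cmod (f x + g x))\<^sup>2 \<le> 2 * (cmod (f x))\<^sup>2 + 2 * (cmod (g x))\<^sup>2" for x
    proof -
      have "(cmod (f x + g x))\<^sup>2 \<le> (cmod (f x) + cmod (g x))\<^sup>2"
        by (intro power_mono norm_triangle_ineq) simp
      also have "\<dots> \<le> 2 * (cmod (f x))\<^sup>2 + 2 * (cmod (g x))\<^sup>2"
        using sum_squares_bound[of "cmod (f x)" "cmod (g x)"] by (simp add: power2_sum)
      finally show ?thesis .
    qed
    then show "AE x in M. norm ((cmod (f x + g x))\<^sup>2)
        \<le> norm (2 * (cmod (f x))\<^sup>2 + 2 * (cmod (g x))\<^sup>2)"
      by (intro AE_I2) (smt (verit) norm_of_real real_norm_def zero_le_power2)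
  qed measurable
  then show ?thesis by (simp add: L2_def)
qed

lemma L2_scale [intro]: "f \<in> L2 M \<Longrightarrow> (\<lambda>x. c * f x) \<in> L2 M"
  by (auto simp: L2_def norm_mult power_mult_distrib)

lemma L2_zero [simp]: "(\<lambda>x. 0) \<in> L2 M"
  by (simp add: L2_def)

lemma L2_sum [intro]: "(\<And>i. i \<in> I \<Longrightarrow> f i \<in> L2 M) \<Longrightarrow> (\<lambda>x. \<Sum>i\<in>I. f i x) \<in> L2 M"
  by (induction I rule: infinite_finite_induct) auto

lemma L2_diff [intro]: "f \<in> L2 M \<Longrightarrow> g \<in> L2 M \<Longrightarrow> (\<lambda>x. f x - g x) \<in> L2 M"
  using L2_add[OF _ L2_scale[of g M "-1"], of f] by simp

lemma L2_product_integrable: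
  assumes [measurable]: "f \<in> L2 M" "g \<in> L2 M"
  shows "integrable M (\<lambda>x. f x * cnj (g x))"
proof (rule Bochner_Integration.integrable_bound)
  show "integrable M (\<lambda>x. (cmod (f x))\<^sup>2 + (cmod (g x))\<^sup>2)"
    using assms by (intro Bochner_Integration.integrable_add L2_integrable_square)
  have "cmod (f x * cnj (g x)) \<le> (cmod (f x))\<^sup>2 + (cmod (g x))\<^sup>2" for x
  proof -
    have "2 * (cmod (f x) * cmod (g x)) \<le> (cmod (f x))\<^sup>2 + (cmod (g x))\<^sup>2"
      using sum_squares_bound[of "cmod (f x)" "cmod (g x)"] by (simp only: mult.assoc)
    moreover have "0 \<le> cmod (f x) * cmod (g x)" by simp
    ultimately show ?thesis unfolding norm_mult complex_mod_cnj by linarith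
  qed
  then show "AE x in M. norm (f x * cnj (g x)) \<le> norm ((cmod (f x))\<^sup>2 + (cmod (g x))\<^sup>2)"
    by (intro AE_I2) simp
qed measurable

lemma L2_inner_add_left:
  "f \<in> L2 M \<Longrightarrow> g \<in> L2 M \<Longrightarrow> h \<in> L2 M \<Longrightarrow>
    L2_inner M (\<lambda>x. f x + g x) h = L2_inner M f h + L2_inner M g h"
  by (simp add: L2_inner_def distrib_right L2_product_integrable)

lemma L2_inner_scale_left: "L2_inner M (\<lambda>x. c * f x) h = c * L2_inner M f h"
  by (simp add: L2_inner_def mult.assoc)

lemma L2_inner_cnj: "L2_inner M g f = cnj (L2_inner M f g)"
proof -
  have "cnj (L2_inner M f g) = (LINT x|M. cnj (f x * cnj (g x)))"
    unfolding L2_inner_def by (rule Bochner_Integration.integral_cnj[symmetric])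
  also have "\<dots> = L2_inner M g f"
    unfolding L2_inner_def by (simp only: complex_cnj_mult complex_cnj_cnj mult.commute)
  finally show ?thesis ..
qed

lemma L2_inner_diff_left:
  "f \<in> L2 M \<Longrightarrow> g \<in> L2 M \<Longrightarrow> h \<in> L2 M \<Longrightarrow>
    L2_inner M (\<lambda>x. f x - g x) h = L2_inner M f h - L2_inner M g h"
  using L2_inner_add_left[of f M "\<lambda>x. (-1) * g x" h] L2_inner_scale_left[of M "-1" g h]
    L2_scale[of g M "-1"] by simp

lemma L2_inner_diff_right:
  "f \<in> L2 M \<Longrightarrow> g \<in> L2 M \<Longrightarrow> h \<in> L2 M \<Longrightarrow>
    L2_inner M h (\<lambda>x. f x - g x) = L2_inner M h f - L2_inner M h g"
  by (simp add: L2_inner_cnj[of M h] L2_inner_diff_left)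

lemma L2_inner_scale_right: "L2_inner M h (\<lambda>x. c * f x) = cnj c * L2_inner M h f"
  by (simp add: L2_inner_cnj[of M h] L2_inner_scale_left)

lemma L2_inner_sum_left:
  assumes "\<And>i. i \<in> I \<Longrightarrow> f i \<in> L2 M" "h \<in> L2 M"
  shows "L2_inner M (\<lambda>x. \<Sum>i\<in>I. f i x) h = (\<Sum>i\<in>I. L2_inner M (f i) h)"
  using assms
proof (induction I rule: infinite_finite_induct)
  case (insert j I)
  have "f j \<in> L2 M" "(\<lambda>x. \<Sum>i\<in>I. f i x) \<in> L2 M" using insert.prems by auto
  then show ?case using insert by (simp add: L2_inner_add_left)
qed (simp_all add: L2_inner_def)

lemma L2_inner_sum_right:
  assumes "\<And>i. i \<in> I \<Longrightarrow> f i \<in> L2 M" "h \<in> L2 M"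
  shows "L2_inner M h (\<lambda>x. \<Sum>i\<in>I. f i x) = (\<Sum>i\<in>I. L2_inner M h (f i))"
  using assms by (simp add: L2_inner_cnj[of M h] L2_inner_sum_left)

lemma L2_inner_self: "L2_inner M f f = of_real (LINT x|M. (cmod (f x))\<^sup>2)"
  unfolding L2_inner_def complex_norm_square[symmetric] integral_complex_of_real ..

lemma L2_inner_cong_AE:
  assumes "AE x in M. f x = f' x"
    and [measurable]: "f \<in> L2 M" "f' \<in> L2 M" "g \<in> L2 M"
  shows "L2_inner M f g = L2_inner M f' g"
  unfolding L2_inner_def
proof (rule integral_cong_AE)
  show "AE x in M. f x * cnj (g x) = f' x * cnj (g x)" using assms(1) by eventually_elim simp
qed measurable

lemma Re_inner_self: "Re_inner M f f = (LINT x|M. (cmod (f x))\<^sup>2)"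
  by (simp add: Re_inner_def L2_inner_self)

lemma L2_norm_square: "(L2_norm M f)\<^sup>2 = Re_inner M f f"
  by (simp add: L2_norm_def Re_inner_self)

lemma real_lc_L2 [intro]: "f \<in> L2 M \<Longrightarrow> g \<in> L2 M \<Longrightarrow> real_lc c f d g \<in> L2 M"
  unfolding real_lc_def by (intro L2_add L2_scale)

lemma L2_inner_lc_left:
  "f \<in> L2 M \<Longrightarrow> g \<in> L2 M \<Longrightarrow> h \<in> L2 M \<Longrightarrow>
    L2_inner M (real_lc c f d g) h = of_real c * L2_inner M f h + of_real d * L2_inner M g h"
  unfolding real_lc_def
  by (subst L2_inner_add_left) (auto simp: L2_inner_scale_left)

lemma L2_semi_inner_space:
  assumes "V \<subseteq> L2 M"
    and "\<And>f g c d. f \<in> V \<Longrightarrow> g \<in> V \<Longrightarrow> real_lc c f d g \<in> V"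
  shows "semi_inner_space V real_lc (Re_inner M)"
proof
  fix f g h c d assume *: "f \<in> V" "g \<in> V"
  then have L: "f \<in> L2 M" "g \<in> L2 M" using assms by auto
  show "real_lc c f d g \<in> V" using assms * by simp
  show "Re_inner M f g = Re_inner M g f"
    by (simp add: Re_inner_def L2_inner_cnj[of M f g])
  assume "h \<in> V"
  then have "h \<in> L2 M" using assms by auto
  then show "Re_inner M (real_lc c f d g) h = c * Re_inner M f h + d * Re_inner M g h"
    using L by (simp add: Re_inner_def L2_inner_lc_left)
next
  fix f show "0 \<le> Re_inner M f f" by (simp add: Re_inner_self)
qed

lemma semi_inner_space_L2: "semi_inner_space (L2 M) real_lc (Re_inner M)"
  by (rule L2_semi_inner_space) auto

lemma Re_inner_zero_AE:
  assumes f: "f \<in> L2 M" shows "Re_inner M f f = 0 \<longleftrightarrow> (AE x in M. f x = 0)"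
  unfolding Re_inner_self
  by (subst integral_nonneg_eq_0_iff_AE) (use f in \<open>auto simp: L2_integrable_square\<close>)

lemma L2_norm_integral_le:
  assumes M: "prob_space M" and [measurable]: "f \<in> L2 M"
  shows "integrable M f" and "(LINT x|M. cmod (f x))\<^sup>2 \<le> Re_inner M f f"
proof -
  interpret prob_space M by fact
  have i: "integrable M (\<lambda>x. (cmod (f x))\<^sup>2)" using assms by (intro L2_integrable_square)
  have ic: "integrable M (\<lambda>x. cmod (f x))"
    by (rule square_integrable_imp_integrable[OF _ i]) measurable
  then show "integrable M f" by (simp add: integrable_norm_iff)
  have "0 \<le> variance (\<lambda>x. cmod (f x))" by (rule variance_positive)
  also have "\<dots> = (LINT x|M. (cmod (f x))\<^sup>2) - (LINT x|M. cmod (f x))\<^sup>2"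
    by (rule variance_eq[OF ic i])
  finally show "(LINT x|M. cmod (f x))\<^sup>2 \<le> Re_inner M f f" by (simp add: Re_inner_self)
qed

text \<open>
  The Riesz--Fischer argument. On a probability space the \<open>L\<^sup>1\<close> norms of the steps are summable too, so
  the steps are almost everywhere absolutely summable and the sequence converges pointwise almost
  everywhere. Fatou's lemma turns the uniform bound on \<open>\<parallel>F\<^sub>k - F\<^bsub>k+m\<^esub>\<parallel>\<close> into one on the distance of \<open>F\<^sub>k\<close> to
  the pointwise limit.
\<close>

lemma L2_fast_Cauchy_convergent:
  assumes M: "prob_space M"
    and F: "\<And>k. F k \<in> L2 M" and s: "0 \<le> s" "s < 1" "0 \<le> B"
    and step: "\<And>k. sqrt (Re_inner M (real_lc 1 (F (Suc k)) (-1) (F k)) (real_lc 1 (F (Suc k)) (-1) (F k)))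
        \<le> B * s ^ k"
  shows "\<exists>w\<in>L2 M. (\<lambda>k. Re_inner M (real_lc 1 (F k) (-1) w) (real_lc 1 (F k) (-1) w)) \<longlonglongrightarrow> 0"
proof -
  interpret prob_space M by fact
  interpret H: semi_inner_space "L2 M" real_lc "Re_inner M" by (rule semi_inner_space_L2)
  note [measurable] = F[THEN L2_measurable]
  define D where "D k x = F (Suc k) x - F k x" for k x
  have D_lc: "real_lc 1 (F (Suc k)) (-1) (F k) = D k" for k by (simp add: real_lc_def D_def fun_eq_iff)
  have DL: "D k \<in> L2 M" for k unfolding D_def by (intro L2_diff F)
  have "(\<integral>\<^sup>+x. (\<Sum>k. ennreal (cmod (D k x))) \<partial>M) = (\<Sum>k. \<integral>\<^sup>+x. ennreal (cmod (D k x)) \<partial>M)"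
    by (rule nn_integral_suminf) (simp add: D_def)
  also have "\<dots> \<le> (\<Sum>k. ennreal (B * s ^ k))"
  proof (rule suminf_le)
    fix k
    have i: "integrable M (D k)" by (rule L2_norm_integral_le(1)[OF M DL])
    have "(\<integral>\<^sup>+x. ennreal (cmod (D k x)) \<partial>M) = ennreal (LINT x|M. cmod (D k x))"
      using i by (intro nn_integral_eq_integral) auto
    also have "(LINT x|M. cmod (D k x)) \<le> sqrt (Re_inner M (D k) (D k))"
      by (rule real_le_rsqrt) (rule L2_norm_integral_le(2)[OF M DL])
    also have "\<dots> \<le> B * s ^ k" using step[of k] D_lc[of k] by simp
    finally show "(\<integral>\<^sup>+x. ennreal (cmod (D k x)) \<partial>M) \<le> ennreal (B * s ^ k)"
      by (simp add: ennreal_leI)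
  qed auto
  also have "\<dots> = ennreal (\<Sum>k. B * s ^ k)"
    using s by (intro suminf_ennreal2 summable_mult summable_geometric) auto
  finally have "(\<integral>\<^sup>+x. (\<Sum>k. ennreal (cmod (D k x))) \<partial>M) \<noteq> \<infinity>"
    by (auto simp: top_unique)
  then have "AE x in M. (\<Sum>k. ennreal (cmod (D k x))) \<noteq> \<infinity>"
    by (intro nn_integral_noteq_infinite) (simp_all add: D_def)
  then have conv: "AE x in M. convergent (\<lambda>k. F k x)"
  proof eventually_elim
    case (elim x)
    then have "summable (\<lambda>k. cmod (D k x))" by (intro summable_suminf_not_top) auto
    then have "summable (\<lambda>k. D k x)" by (rule summable_norm_cancel)
    then have "convergent (\<lambda>n. \<Sum>k<n. D k x)" by (simp add: summable_iff_convergent)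
    moreover have "(\<Sum>k<n. D k x) = F n x - F 0 x" for n
      unfolding D_def by (rule sum_lessThan_telescope)
    ultimately have "convergent (\<lambda>n. (F n x - F 0 x) + F 0 x)"
      by (intro convergent_add convergent_const) simp
    then show ?case by simp
  qed
  define w where "w x = lim (\<lambda>k. F k x)" for x
  have [measurable]: "w \<in> borel_measurable M" unfolding w_def by measurable
  have bound: "(\<integral>\<^sup>+x. ennreal ((cmod (F k x - w x))\<^sup>2) \<partial>M) \<le> ennreal ((B * s ^ k / (1 - s))\<^sup>2)" for k
  proof -
    have "(\<integral>\<^sup>+x. ennreal ((cmod (F k x - w x))\<^sup>2) \<partial>M)
       = (\<integral>\<^sup>+x. liminf (\<lambda>m. ennreal ((cmod (F (k + m) x - F k x))\<^sup>2)) \<partial>M)"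
    proof (rule nn_integral_cong_AE)
      show "AE x in M. ennreal ((cmod (F k x - w x))\<^sup>2)
        = liminf (\<lambda>m. ennreal ((cmod (F (k + m) x - F k x))\<^sup>2))"
        using conv
      proof eventually_elim
        case (elim x)
        then have "(\<lambda>m. F m x) \<longlonglongrightarrow> w x" unfolding w_def by (simp add: convergent_LIMSEQ_iff)
        then have "(\<lambda>m. F (m + k) x) \<longlonglongrightarrow> w x" by (rule LIMSEQ_ignore_initial_segment)
        then have "(\<lambda>m. ennreal ((cmod (F (k + m) x - F k x))\<^sup>2))
          \<longlonglongrightarrow> ennreal ((cmod (w x - F k x))\<^sup>2)"
          by (intro tendsto_intros) (simp add: add.commute)
        then show ?case by (metis lim_imp_Liminf norm_minus_commute sequentially_bot)
      qed
    qed
    also have "\<dots> \<le> liminf (\<lambda>m. \<integral>\<^sup>+x. ennreal ((cmod (F (k + m) x - F k x))\<^sup>2) \<partial>M)"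
      by (rule nn_integral_liminf) measurable
    also have "\<dots> \<le> liminf (\<lambda>m::nat. ennreal ((B * s ^ k / (1 - s))\<^sup>2))"
    proof (rule Liminf_mono, rule always_eventually, rule allI)
      fix m
      let ?d = "real_lc 1 (F (k + m)) (-1) (F k)"
      have d: "?d = (\<lambda>x. F (k + m) x - F k x)" by (simp add: real_lc_def)
      have "(\<integral>\<^sup>+x. ennreal ((cmod (F (k + m) x - F k x))\<^sup>2) \<partial>M)
          = ennreal (LINT x|M. (cmod (F (k + m) x - F k x))\<^sup>2)"
        by (intro nn_integral_eq_integral L2_integrable_square L2_diff F) auto
      also have "\<dots> = ennreal (Re_inner M ?d ?d)" by (simp add: Re_inner_self d)
      also have "Re_inner M ?d ?d \<le> (B * s ^ k / (1 - s))\<^sup>2"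
        using H.norm_telescope_le[OF F step s, of k m] by (rule sqrt_le_D)
      finally show "(\<integral>\<^sup>+x. ennreal ((cmod (F (k + m) x - F k x))\<^sup>2) \<partial>M)
          \<le> ennreal ((B * s ^ k / (1 - s))\<^sup>2)" by (simp add: ennreal_leI)
    qed
    also have "\<dots> = ennreal ((B * s ^ k / (1 - s))\<^sup>2)" by (intro Liminf_const) simp
    finally show ?thesis .
  qed
  have dL: "(\<lambda>x. F k x - w x) \<in> L2 M" for k
    unfolding L2_def using bound[of k]
    by (auto intro!: integrableI_bounded simp: le_less_trans[OF _ ennreal_less_top])
  have wL: "w \<in> L2 M" using L2_diff[OF F[of 0] dL[of 0]] by simp
  have lc_w: "real_lc 1 (F k) (-1) w = (\<lambda>x. F k x - w x)" for k by (simp add: real_lc_def)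
  have le: "Re_inner M (real_lc 1 (F k) (-1) w) (real_lc 1 (F k) (-1) w) \<le> (B * s ^ k / (1 - s))\<^sup>2" for k
  proof -
    have "ennreal (LINT x|M. (cmod (F k x - w x))\<^sup>2) = (\<integral>\<^sup>+x. ennreal ((cmod (F k x - w x))\<^sup>2) \<partial>M)"
      using L2_integrable_square[OF dL[of k]] by (intro nn_integral_eq_integral[symmetric]) auto
    also note bound[of k]
    finally show ?thesis by (simp add: Re_inner_self lc_w)
  qed
  have "(\<lambda>k. (B * s ^ k / (1 - s))\<^sup>2) \<longlonglongrightarrow> (B * 0 / (1 - s))\<^sup>2"
    using s by (intro tendsto_intros LIMSEQ_realpow_zero) auto
  then have "(\<lambda>k. (B * s ^ k / (1 - s))\<^sup>2) \<longlonglongrightarrow> 0" by simp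
  then have "(\<lambda>k. Re_inner M (real_lc 1 (F k) (-1) w) (real_lc 1 (F k) (-1) w)) \<longlonglongrightarrow> 0"
    by (rule tendsto_sandwich[rotated 2, OF tendsto_const]) (use le in \<open>auto simp: Re_inner_self\<close>)
  then show ?thesis using wL by blast
qed

section \<open>Markov kernels as contractions\<close>

lemma markov_kernelD:
  assumes "markov_kernel M K" "x \<in> space M"
  shows "prob_space (K x)" "sets (K x) = sets M" "space (K x) = space M"
proof -
  have "K x \<in> space (prob_algebra M)"
    using assms by (auto simp: markov_kernel_def dest: measurable_space)
  then show "prob_space (K x)" "sets (K x) = sets M" by (auto simp: space_prob_algebra)
  then show "space (K x) = space M" by (metis sets_eq_imp_space_eq)
qed

lemma kernel_op_indicator:
  assumes "markov_kernel M K" "x \<in> space M" "A \<in> sets M"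
  shows "kernel_op K (indicator A) x = of_real (measure (K x) A)"
proof -
  interpret prob_space "K x" by (rule markov_kernelD) fact+
  have "A \<in> sets (K x)" using markov_kernelD[OF assms(1,2)] assms(3) by simp
  then have "(LINT y|K x. complex_of_real (indicator A y)) = of_real (measure (K x) A)"
    by (simp only: integral_complex_of_real) simp
  also have "(\<lambda>y. complex_of_real (indicator A y)) = indicator A"
    by (simp add: indicator_def fun_eq_iff)
  finally show ?thesis by (simp add: kernel_op_def)
qed

lemma indicator_L2:
  assumes "prob_space M" "A \<in> sets M" shows "indicator A \<in> L2 M"
proof -
  interpret prob_space M by fact
  have "(\<lambda>x. (cmod (indicator A x))\<^sup>2) = (indicator A :: _ \<Rightarrow> real)"
    by (auto simp: indicator_def)
  then show ?thesis using assms by (simp add: L2_def less_top[symmetric])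
qed

lemma L2_inner_indicator:
  assumes "A \<in> sets M"
  shows "L2_inner M (indicator A) (indicator A) = of_real (measure M A)"
proof -
  have "(\<lambda>x. (cmod (indicator A x))\<^sup>2) = (indicator A :: _ \<Rightarrow> real)"
    by (auto simp: indicator_def)
  then show ?thesis using assms by (simp add: L2_inner_self)
qed

lemma L2_inner_kernel_op_indicator:
  assumes M: "prob_space M" and K: "markov_kernel M K" and [measurable]: "A \<in> sets M" "B \<in> sets M"
  shows "L2_inner M (kernel_op K (indicator A)) (indicator B)
     = of_real (LINT x:B|M. measure (K x) A)"
proof -
  have "L2_inner M (kernel_op K (indicator A)) (indicator B)
     = (LINT x|M. of_real (indicator B x *\<^sub>R measure (K x) A))"
    unfolding L2_inner_def
    by (rule Bochner_Integration.integral_cong)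
      (auto simp: kernel_op_indicator[OF K] indicator_def)
  then show ?thesis unfolding set_lebesgue_integral_def integral_complex_of_real .
qed

text \<open>
  Testing self-adjointness against the constant function, which a Markov kernel fixes, gives
  \<open>\<integral> K(x, A) \<pi>(dx) = \<langle>K 1\<^sub>A, 1\<rangle> = \<langle>1\<^sub>A, K 1\<rangle> = \<pi>(A)\<close>.
\<close>

lemma selfadjoint_kernel_invariant:
  assumes M: "prob_space M" and K: "markov_kernel M K"
    and sa: "\<And>f g. f \<in> L2 M \<Longrightarrow> g \<in> L2 M \<Longrightarrow>
      L2_inner M (kernel_op K f) g = L2_inner M f (kernel_op K g)"
  shows "M \<bind> K = M"
proof -
  interpret prob_space M by fact
  have Km: "K \<in> M \<rightarrow>\<^sub>M prob_algebra M" using K by (simp add: markov_kernel_def)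
  have meas: "(\<lambda>x. measure (K x) A) \<in> borel_measurable M" if "A \<in> sets M" for A
    using measure_measurable_prob_algebra2[of M "\<lambda>_. A" M K] Km that by simp
  show ?thesis
  proof (rule measure_eqI)
    show s: "sets (M \<bind> K) = sets M"
      using Km by (intro sets_bind) (auto simp: not_empty markov_kernelD[OF K])
    fix A assume "A \<in> sets (M \<bind> K)"
    then have A: "A \<in> sets M" using s by simp
    have "emeasure (M \<bind> K) A = (\<integral>\<^sup>+x. emeasure (K x) A \<partial>M)"
      using Km A by (intro emeasure_bind) (auto simp: not_empty intro: measurable_prob_algebraD)
    also have "\<dots> = (\<integral>\<^sup>+x. ennreal (measure (K x) A) \<partial>M)"
    proof (rule nn_integral_cong)
      fix x assume "x \<in> space M"
      then interpret Kx: prob_space "K x" by (rule markov_kernelD[OF K])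
      show "emeasure (K x) A = ennreal (measure (K x) A)" by (rule Kx.emeasure_eq_measure)
    qed
    also have "\<dots> = ennreal (LINT x|M. measure (K x) A)"
    proof (rule nn_integral_eq_integral)
      show "integrable M (\<lambda>x. measure (K x) A)"
        by (rule integrable_const_bound[where B = 1])
          (use meas[OF A] markov_kernelD[OF K] in \<open>auto intro!: AE_I2 prob_space.prob_le_1\<close>)
    qed simp
    also have "(LINT x|M. measure (K x) A) = measure M A"
    proof -
      have one: "indicator (space M) \<in> L2 M" and iA: "indicator A \<in> L2 M"
        using A by (auto intro: indicator_L2[OF M])
      have "of_real (LINT x|M. measure (K x) A) = L2_inner M (kernel_op K (indicator A)) (indicator (space M))"
        unfolding L2_inner_kernel_op_indicator[OF M K A sets.top] set_lebesgue_integral_def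
        by (intro arg_cong[where f = of_real] Bochner_Integration.integral_cong) simp_all
      also have "\<dots> = L2_inner M (indicator A) (kernel_op K (indicator (space M)))"
        by (rule sa[OF iA one])
      also have "\<dots> = L2_inner M (indicator A) (indicator A)"
        unfolding L2_inner_def
      proof (rule Bochner_Integration.integral_cong[OF refl])
        fix x assume x: "x \<in> space M"
        interpret Kx: prob_space "K x" by (rule markov_kernelD[OF K x])
        have "kernel_op K (indicator (space M)) x = 1"
          using kernel_op_indicator[OF K x sets.top] Kx.prob_space markov_kernelD(3)[OF K x] by simp
        then show "indicator A x * cnj (kernel_op K (indicator (space M)) x)
            = indicator A x * cnj (indicator A x)"
          by (simp add: indicator_def)
      qed
      also have "\<dots> = of_real (measure M A)" by (rule L2_inner_indicator[OF A])
      finally show ?thesis using of_real_eq_iff by blast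
    qed
    finally show "emeasure (M \<bind> K) A = emeasure M A" by (simp add: emeasure_eq_measure)
  qed
qed

text \<open>
  Jensen's inequality for each law \<open>K x\<close>, integrated against the invariant measure. At a point where
  \<open>|f|\<^sup>2\<close> has infinite \<open>K x\<close>-integral the pointwise inequality is trivial.
\<close>

lemma invariant_kernel_contraction:
  assumes M: "prob_space M" and K: "markov_kernel M K" and inv: "M \<bind> K = M"
    and f: "f \<in> L2 M" and Kf: "kernel_op K f \<in> L2 M"
  shows "Re_inner M (kernel_op K f) (kernel_op K f) \<le> Re_inner M f f"
proof -
  interpret prob_space M by fact
  have Km: "K \<in> M \<rightarrow>\<^sub>M prob_algebra M" using K by (simp add: markov_kernel_def)
  have fm[measurable]: "f \<in> borel_measurable M" using f by measurable
  have "(\<integral>\<^sup>+x. ennreal ((cmod (f x))\<^sup>2) \<partial>M) = (\<integral>\<^sup>+x. ennreal ((cmod (f x))\<^sup>2) \<partial>(M \<bind> K))"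
    by (simp add: inv)
  also have "\<dots> = (\<integral>\<^sup>+x. \<integral>\<^sup>+y. ennreal ((cmod (f y))\<^sup>2) \<partial>K x \<partial>M)"
    by (rule nn_integral_bind[OF _ measurable_prob_algebraD[OF Km]]) measurable
  finally have eq: "(\<integral>\<^sup>+x. ennreal ((cmod (f x))\<^sup>2) \<partial>M) = (\<integral>\<^sup>+x. \<integral>\<^sup>+y. ennreal ((cmod (f y))\<^sup>2) \<partial>K x \<partial>M)" .
  have fin: "(\<integral>\<^sup>+x. ennreal ((cmod (f x))\<^sup>2) \<partial>M) = ennreal (Re_inner M f f)"
    unfolding Re_inner_self using L2_integrable_square[OF f] by (intro nn_integral_eq_integral) auto
  have jensen: "ennreal ((cmod (kernel_op K f x))\<^sup>2) \<le> (\<integral>\<^sup>+y. ennreal ((cmod (f y))\<^sup>2) \<partial>K x)"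
    if x: "x \<in> space M" for x
  proof (cases "(\<integral>\<^sup>+y. ennreal ((cmod (f y))\<^sup>2) \<partial>K x) = \<infinity>")
    case False
    have [measurable]: "f \<in> borel_measurable (K x)"
      using fm measurable_cong_sets[OF markov_kernelD(2)[OF K x] refl] by blast
    have i: "integrable (K x) (\<lambda>y. (cmod (f y))\<^sup>2)"
      using False by (intro integrableI_bounded) (auto simp: less_top)
    then have fK: "f \<in> L2 (K x)" by (simp add: L2_def)
    have "cmod (kernel_op K f x) \<le> (LINT y|K x. cmod (f y))"
      unfolding kernel_op_def by (rule integral_norm_bound)
    then have "(cmod (kernel_op K f x))\<^sup>2 \<le> (LINT y|K x. cmod (f y))\<^sup>2"
      by (intro power_mono) auto
    also have "\<dots> \<le> Re_inner (K x) f f"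
      by (rule L2_norm_integral_le(2)[OF markov_kernelD(1)[OF K x] fK])
    finally have "ennreal ((cmod (kernel_op K f x))\<^sup>2) \<le> ennreal (Re_inner (K x) f f)"
      by (rule ennreal_leI)
    also have "\<dots> = (\<integral>\<^sup>+y. ennreal ((cmod (f y))\<^sup>2) \<partial>K x)"
      unfolding Re_inner_self using i by (intro nn_integral_eq_integral[symmetric]) auto
    finally show ?thesis .
  qed simp
  have "ennreal (Re_inner M (kernel_op K f) (kernel_op K f)) = (\<integral>\<^sup>+x. ennreal ((cmod (kernel_op K f x))\<^sup>2) \<partial>M)"
    unfolding Re_inner_self using L2_integrable_square[OF Kf]
    by (intro nn_integral_eq_integral[symmetric]) auto
  also have "\<dots> \<le> (\<integral>\<^sup>+x. \<integral>\<^sup>+y. ennreal ((cmod (f y))\<^sup>2) \<partial>K x \<partial>M)"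
    by (rule nn_integral_mono) (rule jensen)
  finally have "ennreal (Re_inner M (kernel_op K f) (kernel_op K f)) \<le> ennreal (Re_inner M f f)"
    by (simp add: eq[symmetric] fin)
  then show ?thesis by (simp add: Re_inner_self)
qed

text \<open>
  The resolvent is a bounded left inverse: it recovers \<open>f\<close> from \<open>(T - z) f\<close>.
\<close>

lemma resolvent_bounded_below:
  assumes z: "of_real z \<in> L2_resolvent_set M T" and T: "\<And>f. f \<in> L2 M \<Longrightarrow> T f \<in> L2 M"
  shows "\<exists>C. \<forall>f\<in>L2 M. Re_inner M f f
    \<le> C * Re_inner M (real_lc 1 (T f) (- z) f) (real_lc 1 (T f) (- z) f)"
proof -
  from z obtain R C where R: "\<And>g. g \<in> L2 M \<Longrightarrow> R g \<in> L2 M"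
    and inv: "\<And>f. f \<in> L2 M \<Longrightarrow> AE x in M. R (\<lambda>y. T f y - of_real z * f y) x = f x"
    and C: "\<And>g. g \<in> L2 M \<Longrightarrow> L2_norm M (R g) \<le> C * L2_norm M g"
    unfolding L2_resolvent_set_def by blast
  have "Re_inner M f f \<le> C\<^sup>2 * Re_inner M (real_lc 1 (T f) (- z) f) (real_lc 1 (T f) (- z) f)"
    if f: "f \<in> L2 M" for f
  proof -
    let ?h = "real_lc 1 (T f) (- z) f"
    have h: "?h \<in> L2 M" using f T by auto
    have h_eq: "(\<lambda>y. T f y - of_real z * f y) = ?h" by (simp add: real_lc_def)
    have "AE x in M. R ?h x = f x" using inv[OF f] unfolding h_eq .
    then have "L2_norm M (R ?h) = L2_norm M f"
      unfolding L2_norm_def using f R[OF h]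
      by (intro arg_cong[where f = sqrt] integral_cong_AE) (auto elim!: eventually_mono)
    then have le: "L2_norm M f \<le> C * L2_norm M ?h" using C[OF h] by simp
    have "0 \<le> L2_norm M f" by (simp add: L2_norm_def)
    then have "(L2_norm M f)\<^sup>2 \<le> (C * L2_norm M ?h)\<^sup>2" using le by (intro power_mono)
    then show ?thesis by (simp add: power_mult_distrib L2_norm_square)
  qed
  then show ?thesis by blast
qed

section \<open>Numerical range under the dominant-eigenvalue assumption\<close>

text \<open>
  The spectrum of \<open>T\<close> lies above \<open>a\<close>, which gives the lower bound. For the upper bound, restrict \<open>T\<close> to the
  closed invariant subspace \<open>V\<close> orthogonal to the dominant eigenvectors and lower the bound along
  \<open>1 = \<lambda>\<^sub>1 \<ge> \<dots> \<ge> \<lambda>\<^sub>n > b\<close>. At each \<open>\<lambda>\<^sub>j\<close> the listing of eigenvalues with full multiplicity leaves no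
  eigenvector in \<open>V\<close>.
\<close>

lemma dominant_numerical_range:
  assumes M: "prob_space M" and dom: "dominant_eigenvalues M K n lam \<phi> a b" and f: "f \<in> L2 M"
  shows "a * Re_inner M f f \<le> Re_inner M (kernel_op K f) f"
    and "(\<And>j. j \<in> {1..n} \<Longrightarrow> L2_inner M f (\<phi> j) = 0) \<Longrightarrow>
      Re_inner M (kernel_op K f) f \<le> b * Re_inner M f f"
proof -
  interpret H: semi_inner_space "L2 M" real_lc "Re_inner M" by (rule semi_inner_space_L2)
  let ?T = "kernel_op K"
  have K: "markov_kernel M K"
    and TL: "\<And>f. f \<in> L2 M \<Longrightarrow> ?T f \<in> L2 M"
    and sa: "\<And>f g. f \<in> L2 M \<Longrightarrow> g \<in> L2 M \<Longrightarrow> L2_inner M (?T f) g = L2_inner M f (?T g)"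
    and n: "1 \<le> n" and lam1: "lam 1 = 1"
    and mono: "\<And>i j. i \<in> {1..n} \<Longrightarrow> j \<in> {1..n} \<Longrightarrow> i \<le> j \<Longrightarrow> lam j \<le> lam i"
    and ab: "a \<le> b" "b < lam n"
    and spec: "L2_spectrum M ?T \<subseteq> complex_of_real ` ({a..b} \<union> lam ` {1..n})"
    and \<phi>L: "\<And>j. j \<in> {1..n} \<Longrightarrow> \<phi> j \<in> L2 M"
    and eig: "\<And>j. j \<in> {1..n} \<Longrightarrow> AE x in M. ?T (\<phi> j) x = complex_of_real (lam j) * \<phi> j x"
    and mult: "\<And>j f. j \<in> {1..n} \<Longrightarrow> f \<in> L2 M \<Longrightarrow>
        AE x in M. ?T f x = complex_of_real (lam j) * f x \<Longrightarrow>
        \<exists>c :: nat \<Rightarrow> complex. AE x in M. f x = (\<Sum>k\<in>{k\<in>{1..n}. lam k = lam j}. c k * \<phi> k x)"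
    using dom unfolding dominant_eigenvalues_def by blast+
  have b_less: "b < lam j" if "j \<in> {1..n}" for j
    using mono[of j n] that ab by fastforce
  have inv: "M \<bind> K = M" using selfadjoint_kernel_invariant[OF M K sa] .
  have bd: "Re_inner M (?T f) (?T f) \<le> 1 * Re_inner M f f" if "f \<in> L2 M" for f
    using invariant_kernel_contraction[OF M K inv that TL[OF that]] by simp
  have symT: "H.symmetric_op ?T"
    unfolding H.symmetric_op_def using TL sa by (simp add: Re_inner_def)
  have gap: "0 \<le> Re_inner M (?T f) (?T f) - (c + d) * Re_inner M (?T f) f + c * d * Re_inner M f f"
    if "c < d" and free: "\<And>z. c < z \<Longrightarrow> z < d \<Longrightarrow> z \<notin> {a..b} \<union> lam ` {1..n}" and "f \<in> L2 M" for c d f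
  proof (rule H.spectral_gap_inequality[OF symT bd \<open>c < d\<close> _ \<open>f \<in> L2 M\<close>])
    fix z assume "c < z" "z < d"
    then have "complex_of_real z \<notin> complex_of_real ` ({a..b} \<union> lam ` {1..n})"
      using free[of z] by (simp add: image_iff)
    then have "complex_of_real z \<in> L2_resolvent_set M ?T"
      using spec by (auto simp: L2_spectrum_def)
    then show "\<exists>C. \<forall>f\<in>L2 M. Re_inner M f f
        \<le> C * Re_inner M (real_lc 1 (?T f) (- z) f) (real_lc 1 (?T f) (- z) f)"
      by (rule resolvent_bounded_below) (rule TL)
  qed
  show "a * Re_inner M f f \<le> Re_inner M (?T f) f"
  proof (rule H.numerical_range_ge[OF symT gap f])
    fix c z assume "c < z" "z < a"
    then show "z \<notin> {a..b} \<union> lam ` {1..n}" using b_less ab by force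
  qed (use f in auto)

  define V where "V = {g \<in> L2 M. \<forall>j\<in>{1..n}. L2_inner M g (\<phi> j) = 0}"
  have VL: "V \<subseteq> L2 M" by (auto simp: V_def)
  interpret N: semi_inner_space V real_lc "Re_inner M"
  proof (rule L2_semi_inner_space[OF VL])
    fix f g c d assume "f \<in> V" "g \<in> V"
    then show "real_lc c f d g \<in> V" using \<phi>L by (auto simp: V_def L2_inner_lc_left)
  qed
  have TV: "?T g \<in> V" if g: "g \<in> V" for g
  proof -
    have gL: "g \<in> L2 M" using g VL by auto
    have "L2_inner M (?T g) (\<phi> j) = 0" if j: "j \<in> {1..n}" for j
    proof -
      have "L2_inner M (?T g) (\<phi> j) = cnj (L2_inner M (?T (\<phi> j)) g)"
        unfolding sa[OF gL \<phi>L[OF j]] by (rule L2_inner_cnj)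
      also have "L2_inner M (?T (\<phi> j)) g = L2_inner M (\<lambda>x. of_real (lam j) * \<phi> j x) g"
        using eig[OF j] TL[OF \<phi>L[OF j]] L2_scale[OF \<phi>L[OF j]] gL by (rule L2_inner_cong_AE)
      also have "\<dots> = of_real (lam j) * cnj (L2_inner M g (\<phi> j))"
        by (simp only: L2_inner_scale_left L2_inner_cnj[of M "\<phi> j" g])
      finally show ?thesis using g j by (simp add: V_def)
    qed
    then show ?thesis using TL[OF gL] by (simp add: V_def)
  qed
  have symN: "N.symmetric_op ?T"
    unfolding N.symmetric_op_def
  proof (intro conjI ballI)
    fix f g assume "f \<in> V" "g \<in> V"
    then have "L2_inner M (?T f) g = L2_inner M f (?T g)" using VL by (intro sa) auto
    then show "Re_inner M (?T f) g = Re_inner M f (?T g)" by (simp only: Re_inner_def)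
  qed (rule TV)
  have complete: "N.geometrically_complete"
    unfolding N.geometrically_complete_def
  proof (intro allI impI)
    fix F B s
    assume F: "\<forall>k. F k \<in> V" and s: "0 \<le> s" "s < 1" "0 \<le> (B::real)"
      and step: "\<forall>k. sqrt (Re_inner M (real_lc 1 (F (Suc k)) (-1) (F k)) (real_lc 1 (F (Suc k)) (-1) (F k)))
         \<le> B * s ^ k"
    have FL: "F k \<in> L2 M" for k using F VL by auto
    obtain w where w: "w \<in> L2 M"
      and lim: "(\<lambda>k. Re_inner M (real_lc 1 (F k) (-1) w) (real_lc 1 (F k) (-1) w)) \<longlonglongrightarrow> 0"
      using L2_fast_Cauchy_convergent[OF M FL s step[rule_format]] by (rule bexE)
    have "L2_inner M w (\<phi> j) = 0" if j: "j \<in> {1..n}" for j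
    proof -
      \<comment> \<open>\<open>V\<close> is closed; complex orthogonality is real orthogonality to \<open>\<phi> j\<close> and to \<open>\<i> \<phi> j\<close>\<close>
      have orth: "Re (L2_inner M w h) = 0" if h: "h \<in> L2 M" and F0: "\<And>k. L2_inner M (F k) h = 0" for h
      proof -
        have "\<bar>Re_inner M w h\<bar> \<le> sqrt (Re_inner M (real_lc 1 (F k) (-1) w) (real_lc 1 (F k) (-1) w))
            * sqrt (Re_inner M h h)" for k
          using H.Cauchy_Schwarz[of "real_lc 1 (F k) (-1) w" h] h w FL[of k] F0[of k]
          by (simp add: Re_inner_def[of M "F k" h])
        moreover have "(\<lambda>k. sqrt (Re_inner M (real_lc 1 (F k) (-1) w) (real_lc 1 (F k) (-1) w))
            * sqrt (Re_inner M h h)) \<longlonglongrightarrow> sqrt 0 * sqrt (Re_inner M h h)"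
          by (intro tendsto_intros lim)
        ultimately have "\<bar>Re_inner M w h\<bar> \<le> sqrt 0 * sqrt (Re_inner M h h)"
          by (intro LIMSEQ_le_const) blast+
        then show ?thesis by (simp add: Re_inner_def)
      qed
      have F\<phi>: "L2_inner M (F k) (\<phi> j) = 0" for k using F j by (auto simp: V_def)
      have "Re (L2_inner M w (\<phi> j)) = 0" by (rule orth[OF \<phi>L[OF j] F\<phi>])
      moreover have "Re (L2_inner M w (\<lambda>x. \<i> * \<phi> j x)) = 0"
        using L2_scale[OF \<phi>L[OF j]] F\<phi> by (intro orth) (auto simp: L2_inner_scale_right)
      ultimately show ?thesis by (simp add: L2_inner_scale_right complex_eq_iff)
    qed
    then have "w \<in> V" using w by (simp add: V_def)
    then show "\<exists>w\<in>V. (\<lambda>k. Re_inner M (real_lc 1 (F k) (-1) w) (real_lc 1 (F k) (-1) w)) \<longlonglongrightarrow> 0"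
      using lim by blast
  qed
  have inj: "Re_inner M w w = 0"
    if j: "j \<in> {1..n}" and w: "w \<in> V"
      and z: "Re_inner M (real_lc 1 (?T w) (- lam j) w) (real_lc 1 (?T w) (- lam j) w) = 0" for j w
  proof -
    have wL: "w \<in> L2 M" using w VL by auto
    then have "AE x in M. real_lc 1 (?T w) (- lam j) w x = 0"
      using z TL[OF wL] by (subst (asm) Re_inner_zero_AE) auto
    then have "AE x in M. ?T w x = complex_of_real (lam j) * w x"
      by eventually_elim (simp add: real_lc_def)
    then obtain c :: "nat \<Rightarrow> complex"
      where c: "AE x in M. w x = (\<Sum>k\<in>{k\<in>{1..n}. lam k = lam j}. c k * \<phi> k x)"
      using mult[OF j wL] by blast
    have "L2_inner M w w = L2_inner M (\<lambda>x. \<Sum>k\<in>{k\<in>{1..n}. lam k = lam j}. c k * \<phi> k x) w"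
      by (rule L2_inner_cong_AE[OF c wL _ wL]) (intro L2_sum L2_scale \<phi>L, blast)
    also have "\<dots> = (\<Sum>k\<in>{k\<in>{1..n}. lam k = lam j}. c k * L2_inner M (\<phi> k) w)"
      using wL \<phi>L by (subst L2_inner_sum_left) (auto simp: L2_inner_scale_left)
    also have "\<dots> = 0"
    proof (intro sum.neutral ballI)
      fix k assume "k \<in> {k\<in>{1..n}. lam k = lam j}"
      then show "c k * L2_inner M (\<phi> k) w = 0"
        using w L2_inner_cnj[of M "\<phi> k" w] by (simp add: V_def)
    qed
    finally show ?thesis by (simp add: Re_inner_def)
  qed
  have descend: "Re_inner M (?T g) g \<le> c * Re_inner M g g"
    if j: "j \<in> {1..n}" and top: "\<And>g. g \<in> V \<Longrightarrow> Re_inner M (?T g) g \<le> lam j * Re_inner M g g"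
      and cj: "c < lam j" and free: "\<And>z. c < z \<Longrightarrow> z < lam j \<Longrightarrow> z \<notin> {a..b} \<union> lam ` {1..n}"
      and g: "g \<in> V" for j c g
    using VL by (intro N.isolated_top_descent[OF complete symN bd cj gap[OF cj free] top inj[OF j] g]) auto
  have top: "j \<le> n \<Longrightarrow> \<forall>g\<in>V. Re_inner M (?T g) g \<le> lam j * Re_inner M g g" if "1 \<le> j" for j
    using that
  proof (induction j rule: nat_induct_at_least)
    case base
    show ?case
    proof
      fix g assume "g \<in> V"
      then have g: "g \<in> L2 M" "?T g \<in> L2 M" using VL TL by auto
      have "0 \<le> Re_inner M (real_lc 1 (?T g) (-1) g) (real_lc 1 (?T g) (-1) g)"
        using g by (intro H.ip_nonneg) auto
      then show "Re_inner M (?T g) g \<le> lam 1 * Re_inner M g g"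
        using bd[OF g(1)] H.ip_lc_square[OF g(2,1), of 1 "-1"] unfolding lam1 by simp
    qed
  next
    case (Suc j)
    then have IH: "\<And>g. g \<in> V \<Longrightarrow> Re_inner M (?T g) g \<le> lam j * Re_inner M g g" by simp
    have j: "j \<in> {1..n}" "Suc j \<in> {1..n}" using Suc by auto
    show ?case
    proof (cases "lam (Suc j) = lam j")
      case True
      then show ?thesis using IH by simp
    next
      case False
      then have less: "lam (Suc j) < lam j" using mono[OF j] by simp
      have "z \<notin> {a..b} \<union> lam ` {1..n}" if "lam (Suc j) < z" "z < lam j" for z
      proof -
        have "lam k \<noteq> z" if k: "k \<in> {1..n}" for k
          using mono[OF k j(1)] mono[OF j(2) k] \<open>lam (Suc j) < z\<close> \<open>z < lam j\<close>
          by (cases "k \<le> j") auto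
        then have "z \<notin> lam ` {1..n}" by blast
        then show ?thesis using b_less[OF j(2)] that by simp
      qed
      then show ?thesis using descend[OF j(1) IH less] by blast
    qed
  qed
  assume "\<And>j. j \<in> {1..n} \<Longrightarrow> L2_inner M f (\<phi> j) = 0"
  then have fV: "f \<in> V" using f by (simp add: V_def)
  show "Re_inner M (?T f) f \<le> b * Re_inner M f f"
  proof (rule descend[OF _ _ _ _ fV])
    show "n \<in> {1..n}" using n by simp
    show "b < lam n" by (rule ab)
    show "Re_inner M (?T g) g \<le> lam n * Re_inner M g g" if "g \<in> V" for g
      using top[OF n] that by simp
    fix z assume "b < z" "z < lam n"
    then show "z \<notin> {a..b} \<union> lam ` {1..n}" using mono[of _ n] n by fastforce
  qed
qed

definition orthonormal_L2 :: "'a measure \<Rightarrow> nat \<Rightarrow> (nat \<Rightarrow> 'a \<Rightarrow> complex) \<Rightarrow> bool" where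
  "orthonormal_L2 M n \<psi> \<longleftrightarrow> (\<forall>j\<in>{1..n}. \<psi> j \<in> L2 M) \<and>
     (\<forall>i\<in>{1..n}. \<forall>j\<in>{1..n}. L2_inner M (\<psi> i) (\<psi> j) = (if i = j then 1 else 0))"

lemma L2_inner_orthonormal_sum:
  assumes "orthonormal_L2 M n \<psi>" "j \<in> {1..n}"
  shows "L2_inner M (\<lambda>x. \<Sum>i=1..n. c i * \<psi> i x) (\<psi> j) = c j"
proof -
  have "L2_inner M (\<lambda>x. \<Sum>i=1..n. c i * \<psi> i x) (\<psi> j) = (\<Sum>i=1..n. c i * L2_inner M (\<psi> i) (\<psi> j))"
    using assms by (subst L2_inner_sum_left) (auto simp: orthonormal_L2_def L2_inner_scale_left)
  also have "\<dots> = (\<Sum>i=1..n. if i = j then c i else 0)"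
    using assms by (intro sum.cong) (auto simp: orthonormal_L2_def)
  finally show ?thesis using assms(2) by simp
qed

text \<open>
  The residual of the projection onto an orthonormal family is orthogonal to the family, and its
  length is given by Pythagoras.
\<close>

lemma orthonormal_remainder:
  assumes on: "orthonormal_L2 M n \<psi>" and f: "f \<in> L2 M"
  defines "g \<equiv> \<lambda>x. f x - (\<Sum>i=1..n. L2_inner M f (\<psi> i) * \<psi> i x)"
  shows "g \<in> L2 M" and "j \<in> {1..n} \<Longrightarrow> L2_inner M g (\<psi> j) = 0"
    and "Re_inner M g g = Re_inner M f f - (\<Sum>i=1..n. (cmod (L2_inner M f (\<psi> i)))\<^sup>2)"
proof -
  define s where "s = (\<lambda>x. \<Sum>i=1..n. L2_inner M f (\<psi> i) * \<psi> i x)"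
  have \<psi>: "\<psi> i \<in> L2 M" if "i \<in> {1..n}" for i using on that by (simp add: orthonormal_L2_def)
  have s: "s \<in> L2 M" unfolding s_def by (intro L2_sum L2_scale \<psi>)
  have g_s: "g = (\<lambda>x. f x - s x)" by (simp add: g_def s_def)
  show gL: "g \<in> L2 M" unfolding g_s using f s by auto
  show orth: "L2_inner M g (\<psi> j) = 0" if "j \<in> {1..n}" for j
    unfolding g_s using L2_inner_orthonormal_sum[OF on that] f s \<psi>[OF that]
    by (simp add: L2_inner_diff_left s_def)
  have "L2_inner M g s = 0"
    unfolding s_def using gL \<psi> by (subst L2_inner_sum_right) (auto simp: L2_inner_scale_right orth)
  then have "L2_inner M g g = L2_inner M g f"
    using gL f s by (subst (2) g_s) (simp add: L2_inner_diff_right)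
  also have "\<dots> = L2_inner M f f - L2_inner M s f"
    using f s by (simp add: g_s L2_inner_diff_left)
  also have "L2_inner M s f = (\<Sum>i=1..n. L2_inner M f (\<psi> i) * cnj (L2_inner M f (\<psi> i)))"
    unfolding s_def using f \<psi>
    by (subst L2_inner_sum_left) (auto simp: L2_inner_scale_left L2_inner_cnj[of M f])
  also have "\<dots> = of_real (\<Sum>i=1..n. (cmod (L2_inner M f (\<psi> i)))\<^sup>2)"
    by (simp only: of_real_sum complex_norm_square)
  finally show "Re_inner M g g = Re_inner M f f - (\<Sum>i=1..n. (cmod (L2_inner M f (\<psi> i)))\<^sup>2)"
    by (simp add: Re_inner_def)
qed

lemma Bessel_inequality:
  assumes "orthonormal_L2 M n \<psi>" "f \<in> L2 M"
  shows "(\<Sum>i=1..n. (cmod (L2_inner M f (\<psi> i)))\<^sup>2) \<le> Re_inner M f f"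
proof -
  have "0 \<le> Re_inner M g g" for g :: "'a \<Rightarrow> complex" by (simp add: Re_inner_self)
  from this[of "\<lambda>x. f x - (\<Sum>i=1..n. L2_inner M f (\<psi> i) * \<psi> i x)"] show ?thesis
    unfolding orthonormal_remainder(3)[OF assms] by simp
qed

lemma Parseval_finite:
  assumes on: "orthonormal_L2 M n \<psi>"
  shows "Re_inner M (\<lambda>x. \<Sum>i=1..n. c i * \<psi> i x) (\<lambda>x. \<Sum>i=1..n. c i * \<psi> i x) = (\<Sum>i=1..n. (cmod (c i))\<^sup>2)"
proof -
  let ?s = "\<lambda>x. \<Sum>i=1..n. c i * \<psi> i x"
  have s: "?s \<in> L2 M" using on by (intro L2_sum L2_scale) (simp add: orthonormal_L2_def)
  have c: "L2_inner M ?s (\<psi> i) = c i" if "i \<in> {1..n}" for i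
    by (rule L2_inner_orthonormal_sum[OF on that])
  have "Re_inner M ?s ?s - (\<Sum>i=1..n. (cmod (L2_inner M ?s (\<psi> i)))\<^sup>2) =
      Re_inner M (\<lambda>x. ?s x - (\<Sum>i=1..n. L2_inner M ?s (\<psi> i) * \<psi> i x))
        (\<lambda>x. ?s x - (\<Sum>i=1..n. L2_inner M ?s (\<psi> i) * \<psi> i x))"
    by (rule orthonormal_remainder(3)[OF on s, symmetric])
  also have "\<dots> = 0" by (simp add: c Re_inner_self del: One_nat_def)
  finally show ?thesis by (simp add: c del: One_nat_def)
qed

text \<open>
  Write \<open>f = s + g\<close> with \<open>s\<close> the projection onto the dominant eigenvectors. Since \<open>T\<close> maps the span of
  the eigenvectors and its orthogonal complement into themselves, the form splits without cross terms.
\<close>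

lemma dominant_quadratic_form:
  assumes M: "prob_space M" and dom: "dominant_eigenvalues M K n lam \<phi> a b" and f: "f \<in> L2 M"
  defines "w \<equiv> \<lambda>j. (cmod (L2_inner M f (\<phi> j)))\<^sup>2"
  shows "(\<Sum>j=1..n. lam j * w j) + a * (Re_inner M f f - (\<Sum>j=1..n. w j)) \<le> Re_inner M (kernel_op K f) f"
    and "Re_inner M (kernel_op K f) f \<le> (\<Sum>j=1..n. lam j * w j) + b * (Re_inner M f f - (\<Sum>j=1..n. w j))"
proof -
  let ?T = "kernel_op K"
  have TL: "\<And>f. f \<in> L2 M \<Longrightarrow> ?T f \<in> L2 M"
    and sa: "\<And>f g. f \<in> L2 M \<Longrightarrow> g \<in> L2 M \<Longrightarrow> L2_inner M (?T f) g = L2_inner M f (?T g)"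
    and on: "orthonormal_L2 M n \<phi>"
    and eig: "\<And>j. j \<in> {1..n} \<Longrightarrow> AE x in M. ?T (\<phi> j) x = complex_of_real (lam j) * \<phi> j x"
    using dom unfolding dominant_eigenvalues_def orthonormal_L2_def by blast+
  have \<phi>: "\<phi> i \<in> L2 M" if "i \<in> {1..n}" for i using on that by (simp add: orthonormal_L2_def)
  have T\<phi>: "L2_inner M (?T (\<phi> j)) h = of_real (lam j) * L2_inner M (\<phi> j) h"
    if j: "j \<in> {1..n}" and h: "h \<in> L2 M" for j h
    using L2_inner_cong_AE[OF eig[OF j] TL[OF \<phi>[OF j]] L2_scale[OF \<phi>[OF j]] h]
    by (simp add: L2_inner_scale_left)
  define c where "c j = L2_inner M f (\<phi> j)" for j
  define s where "s = (\<lambda>x. \<Sum>i=1..n. c i * \<phi> i x)"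
  define g where "g = (\<lambda>x. f x - s x)"
  have s: "s \<in> L2 M" unfolding s_def by (intro L2_sum L2_scale \<phi>)
  have g: "g \<in> L2 M" and orth: "\<And>j. j \<in> {1..n} \<Longrightarrow> L2_inner M g (\<phi> j) = 0"
    and gg: "Re_inner M g g = Re_inner M f f - (\<Sum>j=1..n. w j)"
    using orthonormal_remainder[OF on f] unfolding g_def s_def c_def w_def by blast+
  have "L2_inner M s (?T g) = (\<Sum>i=1..n. c i * L2_inner M (?T (\<phi> i)) g)"
    unfolding s_def using TL[OF g] \<phi> g sa
    by (subst L2_inner_sum_left) (auto simp: L2_inner_scale_left intro!: sum.cong)
  also have "\<dots> = 0"
    using T\<phi>[OF _ g] orth L2_inner_cnj[of M _ g] by (intro sum.neutral) simp
  finally have sTg: "L2_inner M s (?T g) = 0" .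
  have f_split: "L2_inner M h f = L2_inner M h g + L2_inner M h s" if "h \<in> L2 M" for h
    using that f s by (simp add: g_def L2_inner_diff_right)
  have "L2_inner M (?T f) g = L2_inner M (?T g) g"
  proof -
    have "L2_inner M (?T f) g = cnj (L2_inner M (?T g) f)"
      unfolding sa[OF f g] by (rule L2_inner_cnj)
    also have "L2_inner M (?T g) f = L2_inner M (?T g) g"
      using f_split[OF TL[OF g]] sTg L2_inner_cnj[of M "?T g" s] by simp
    also have "cnj (L2_inner M (?T g) g) = L2_inner M (?T g) g"
      by (subst (2) sa[OF g g]) (rule L2_inner_cnj[symmetric])
    finally show ?thesis .
  qed
  moreover have "L2_inner M (?T f) s = of_real (\<Sum>j=1..n. lam j * w j)"
  proof -
    have "L2_inner M (?T f) s = (\<Sum>j=1..n. cnj (c j) * L2_inner M (?T f) (\<phi> j))"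
      unfolding s_def using TL[OF f] \<phi> by (subst L2_inner_sum_right) (auto simp: L2_inner_scale_right)
    also have "\<dots> = (\<Sum>j=1..n. of_real (lam j * w j))"
    proof (rule sum.cong[OF refl])
      fix j assume j: "j \<in> {1..n}"
      have "L2_inner M (?T f) (\<phi> j) = cnj (L2_inner M (?T (\<phi> j)) f)"
        unfolding sa[OF f \<phi>[OF j]] by (rule L2_inner_cnj)
      also have "\<dots> = of_real (lam j) * c j"
        by (simp only: T\<phi>[OF j f] c_def L2_inner_cnj[of M f "\<phi> j"] complex_cnj_mult
            complex_cnj_complex_of_real)
      finally show "cnj (c j) * L2_inner M (?T f) (\<phi> j) = of_real (lam j * w j)"
        unfolding w_def c_def of_real_mult complex_norm_square by (simp add: mult_ac)
    qed
    finally show ?thesis by simp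
  qed
  ultimately have eq: "Re_inner M (?T f) f = (\<Sum>j=1..n. lam j * w j) + Re_inner M (?T g) g"
    using f_split[OF TL[OF f]] by (simp add: Re_inner_def)
  show "(\<Sum>j=1..n. lam j * w j) + a * (Re_inner M f f - (\<Sum>j=1..n. w j)) \<le> Re_inner M (?T f) f"
    using dominant_numerical_range(1)[OF M dom g] eq gg by simp
  show "Re_inner M (?T f) f \<le> (\<Sum>j=1..n. lam j * w j) + b * (Re_inner M f f - (\<Sum>j=1..n. w j))"
    using dominant_numerical_range(2)[OF M dom g orth] eq gg by simp
qed

section \<open>Metastability as a partial trace\<close>

definition cell_vector :: "'a measure \<Rightarrow> (nat \<Rightarrow> 'a set) \<Rightarrow> nat \<Rightarrow> 'a \<Rightarrow> complex" where
  "cell_vector M A i = (\<lambda>x. of_real (1 / sqrt (measure M (A i))) * indicator (A i) x)"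

lemma orthonormal_cell_vectors:
  assumes M: "prob_space M" and A: "measurable_partition M n A"
  shows "orthonormal_L2 M n (cell_vector M A)"
  unfolding orthonormal_L2_def
proof (intro conjI ballI)
  fix i j assume i: "i \<in> {1..n}"
  have Ai: "A i \<in> sets M" "measure M (A i) > 0" using A i by (auto simp: measurable_partition_def)
  show "cell_vector M A i \<in> L2 M"
    unfolding cell_vector_def by (intro L2_scale indicator_L2[OF M] Ai)
  assume j: "j \<in> {1..n}"
  show "L2_inner M (cell_vector M A i) (cell_vector M A j) = (if i = j then 1 else 0)"
  proof (cases "i = j")
    case True
    have "complex_of_real (1 / sqrt (measure M (A i))) *
        (cnj (complex_of_real (1 / sqrt (measure M (A i)))) * of_real (measure M (A i)))
        = of_real (1 / sqrt (measure M (A i)) * (1 / sqrt (measure M (A i)) * measure M (A i)))"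
      by (simp only: complex_cnj_complex_of_real of_real_mult)
    also have "1 / sqrt (measure M (A i)) * (1 / sqrt (measure M (A i)) * measure M (A i)) = 1"
      using Ai by (simp add: field_simps)
    finally show ?thesis
      unfolding cell_vector_def L2_inner_scale_left L2_inner_scale_right
        L2_inner_indicator[OF Ai(1)] True[symmetric] by (simp only: if_True of_real_1 simp_thms)
  next
    case False
    then have "A i \<inter> A j = {}"
      using A i j by (auto simp: measurable_partition_def disjoint_family_on_def)
    then have "L2_inner M (indicator (A i)) (indicator (A j)) = 0"
      unfolding L2_inner_def by (subst Bochner_Integration.integral_cong[where g = "\<lambda>_. 0" and N = M])
        (auto simp: indicator_def)
    then show ?thesis
      using False unfolding cell_vector_def L2_inner_scale_left L2_inner_scale_right by simp
  qed
qed

text \<open>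
  Each diagonal entry \<open>\<langle>K e\<^sub>i, e\<^sub>i\<rangle>\<close> is \<open>\<pi>(A\<^sub>i)\<^sup>-\<^sup>1 \<integral>\<^bsub>A\<^sub>i\<^esub> K(x, A\<^sub>i) \<pi>(dx)\<close>, the probability of staying in the
  cell in one stationary step.
\<close>

lemma metastability_trace:
  assumes M: "prob_space M" and K: "markov_kernel M K" and A: "measurable_partition M n A"
  shows "metastability M K n A
    = (\<Sum>i=1..n. Re_inner M (kernel_op K (cell_vector M A i)) (cell_vector M A i))"
  unfolding metastability_def
proof (rule sum.cong[OF refl])
  fix i assume i: "i \<in> {1..n}"
  have Ai: "A i \<in> sets M" "measure M (A i) > 0" using A i by (auto simp: measurable_partition_def)
  let ?c = "complex_of_real (1 / sqrt (measure M (A i)))"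
  have "kernel_op K (cell_vector M A i) = (\<lambda>x. ?c * kernel_op K (indicator (A i)) x)"
    unfolding kernel_op_def cell_vector_def by simp
  then have "L2_inner M (kernel_op K (cell_vector M A i)) (cell_vector M A i)
      = ?c * (cnj ?c * of_real (LINT x:A i|M. measure (K x) (A i)))"
    by (simp only: cell_vector_def L2_inner_scale_left L2_inner_scale_right
        L2_inner_kernel_op_indicator[OF M K Ai(1,1)])
  also have "\<dots> = of_real (1 / sqrt (measure M (A i)) *
      (1 / sqrt (measure M (A i)) * (LINT x:A i|M. measure (K x) (A i))))"
    by (simp only: complex_cnj_complex_of_real of_real_mult)
  finally show "transition_prob M K (A i) (A i)
      = Re_inner M (kernel_op K (cell_vector M A i)) (cell_vector M A i)"
    using Ai by (simp add: Re_inner_def transition_prob_def)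
qed

text \<open>
  Summing \<open>dominant_quadratic_form\<close> over the unit vectors of the cells and exchanging the two sums
  turns the weights into \<open>\<rho>\<close>. Bessel's inequality for the cell vectors gives \<open>\<rho>\<^sub>j \<le> 1\<close>.
\<close>

lemma selfadjoint_metastability_bounds:
  assumes M: "prob_space M" and dom: "dominant_eigenvalues M K n lam \<phi> a b"
    and A: "measurable_partition M n A"
  defines "\<rho> \<equiv> \<lambda>j. \<Sum>i=1..n. (cmod (L2_inner M (\<phi> j) (cell_vector M A i)))\<^sup>2"
  shows "j \<in> {1..n} \<Longrightarrow> \<rho> j \<in> {0..1}"
    and "1 + (\<Sum>j=2..n. \<rho> j * lam j) + a * (\<Sum>j=2..n. 1 - \<rho> j) \<le> metastability M K n A"
    and "metastability M K n A \<le> 1 + (\<Sum>j=2..n. lam j)"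
proof -
  interpret prob_space M by fact
  let ?e = "cell_vector M A"
  have K: "markov_kernel M K" and n: "1 \<le> n" and lam1: "lam 1 = 1"
    and mono: "\<And>i j. i \<in> {1..n} \<Longrightarrow> j \<in> {1..n} \<Longrightarrow> i \<le> j \<Longrightarrow> lam j \<le> lam i"
    and bn: "b < lam n"
    and on: "orthonormal_L2 M n \<phi>"
    and \<phi>1: "AE x in M. \<phi> 1 x = 1"
    using dom unfolding dominant_eigenvalues_def orthonormal_L2_def by blast+
  have \<phi>: "\<phi> i \<in> L2 M" if "i \<in> {1..n}" for i using on that by (simp add: orthonormal_L2_def)
  have b_le: "b \<le> lam j" if "j \<in> {1..n}" for j using mono[OF that, of n] that bn by fastforce
  have one: "1 \<in> {1..n}" using n by simp
  have one_rest: "{1..n} = insert 1 {2..n}" using n by auto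
  note one_e = orthonormal_cell_vectors[OF M A]
  have e: "?e i \<in> L2 M" and ee: "Re_inner M (?e i) (?e i) = 1" if "i \<in> {1..n}" for i
    using one_e that by (auto simp: orthonormal_L2_def Re_inner_def)
  have \<rho>01: "\<rho> j \<in> {0..1}" if j: "j \<in> {1..n}" for j
  proof -
    have "\<rho> j \<le> Re_inner M (\<phi> j) (\<phi> j)"
      unfolding \<rho>_def by (rule Bessel_inequality[OF one_e \<phi>[OF j]])
    also have "\<dots> = 1" using on j by (simp add: orthonormal_L2_def Re_inner_def)
    finally show ?thesis by (simp add: \<rho>_def sum_nonneg)
  qed
  then show "j \<in> {1..n} \<Longrightarrow> \<rho> j \<in> {0..1}" for j .
  have \<rho>1: "\<rho> 1 = 1"
  proof -
    have "(cmod (L2_inner M (\<phi> 1) (?e i)))\<^sup>2 = measure M (A i)" if i: "i \<in> {1..n}" for i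
    proof -
      have Ai: "A i \<in> sets M" "measure M (A i) > 0" using A i by (auto simp: measurable_partition_def)
      have iX: "indicator (space M) \<in> L2 M" by (rule indicator_L2[OF M]) simp
      have "AE x in M. \<phi> 1 x = indicator (space M) x" using \<phi>1 AE_space by eventually_elim simp
      then have "L2_inner M (\<phi> 1) (?e i) = L2_inner M (indicator (space M)) (?e i)"
        by (rule L2_inner_cong_AE[OF _ \<phi>[OF one] iX e[OF i]])
      also have "\<dots> = of_real (1 / sqrt (measure M (A i))) * L2_inner M (indicator (A i)) (indicator (A i))"
        unfolding cell_vector_def L2_inner_scale_right
        unfolding L2_inner_def
        by (rule arg_cong2[where f = "(*)"], simp, rule Bochner_Integration.integral_cong)
          (auto simp: indicator_def)
      also have "\<dots> = of_real (1 / sqrt (measure M (A i)) * measure M (A i))"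
        by (simp add: L2_inner_indicator[OF Ai(1)])
      also have "1 / sqrt (measure M (A i)) * measure M (A i) = sqrt (measure M (A i))"
        using Ai by (simp add: field_simps)
      finally show ?thesis using Ai by (simp add: norm_of_real)
    qed
    then have "\<rho> 1 = (\<Sum>i=1..n. measure M (A i))" by (simp add: \<rho>_def)
    also have "\<dots> = measure M (\<Union>i\<in>{1..n}. A i)"
      using A by (intro finite_measure_finite_Union[symmetric]) (auto simp: measurable_partition_def)
    also have "\<dots> = 1" using A by (simp add: measurable_partition_def prob_space)
    finally show ?thesis .
  qed
  have swap: "(\<Sum>i=1..n. (\<Sum>j=1..n. lam j * (cmod (L2_inner M (?e i) (\<phi> j)))\<^sup>2)
        + t * (Re_inner M (?e i) (?e i) - (\<Sum>j=1..n. (cmod (L2_inner M (?e i) (\<phi> j)))\<^sup>2)))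
      = 1 + (\<Sum>j=2..n. \<rho> j * lam j) + t * (\<Sum>j=2..n. 1 - \<rho> j)" for t
  proof -
    have cm: "cmod (L2_inner M (?e i) (\<phi> j)) = cmod (L2_inner M (\<phi> j) (?e i))" for i j
      using L2_inner_cnj[of M "?e i" "\<phi> j"] by simp
    have r1: "(\<Sum>i=1..n. \<Sum>j=1..n. lam j * (cmod (L2_inner M (?e i) (\<phi> j)))\<^sup>2) = (\<Sum>j=1..n. \<rho> j * lam j)"
      unfolding cm \<rho>_def by (subst sum.swap) (simp add: sum_distrib_left mult.commute)
    have r2: "(\<Sum>i=1..n. \<Sum>j=1..n. (cmod (L2_inner M (?e i) (\<phi> j)))\<^sup>2) = (\<Sum>j=1..n. \<rho> j)"
      unfolding cm \<rho>_def by (rule sum.swap)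
    have "(\<Sum>i=1..n. (\<Sum>j=1..n. lam j * (cmod (L2_inner M (?e i) (\<phi> j)))\<^sup>2)
        + t * (Re_inner M (?e i) (?e i) - (\<Sum>j=1..n. (cmod (L2_inner M (?e i) (\<phi> j)))\<^sup>2)))
      = (\<Sum>j=1..n. \<rho> j * lam j) + t * ((\<Sum>i=1..n. Re_inner M (?e i) (?e i)) - (\<Sum>j=1..n. \<rho> j))"
      by (simp only: sum.distrib sum_distrib_left[symmetric] sum_subtractf r1 r2)
    also have "(\<Sum>i=1..n. Re_inner M (?e i) (?e i)) - (\<Sum>j=1..n. \<rho> j) = (\<Sum>j=1..n. 1 - \<rho> j)"
      using ee by (simp add: sum_subtractf)
    also have "\<dots> = (\<Sum>j=2..n. 1 - \<rho> j)" unfolding one_rest using \<rho>1 by simp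
    also have "(\<Sum>j=1..n. \<rho> j * lam j) = 1 + (\<Sum>j=2..n. \<rho> j * lam j)"
      unfolding one_rest using \<rho>1 lam1 by simp
    finally show ?thesis .
  qed
  show "1 + (\<Sum>j=2..n. \<rho> j * lam j) + a * (\<Sum>j=2..n. 1 - \<rho> j) \<le> metastability M K n A"
    unfolding metastability_trace[OF M K A] swap[symmetric]
    using dominant_quadratic_form(1)[OF M dom e] by (intro sum_mono) auto
  have "metastability M K n A \<le> 1 + (\<Sum>j=2..n. \<rho> j * lam j) + b * (\<Sum>j=2..n. 1 - \<rho> j)"
    unfolding metastability_trace[OF M K A] swap[symmetric]
    using dominant_quadratic_form(2)[OF M dom e] by (intro sum_mono) auto
  also have "\<dots> = 1 + (\<Sum>j=2..n. \<rho> j * lam j + b * (1 - \<rho> j))"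
    by (simp add: sum.distrib sum_distrib_left)
  also have "\<dots> \<le> 1 + (\<Sum>j=2..n. lam j)"
  proof (intro add_left_mono sum_mono)
    fix j assume "j \<in> {2..n}"
    then have j: "j \<in> {1..n}" by simp
    have "b * (1 - \<rho> j) \<le> lam j * (1 - \<rho> j)"
      using \<rho>01[OF j] b_le[OF j] by (intro mult_right_mono) auto
    then show "\<rho> j * lam j + b * (1 - \<rho> j) \<le> lam j" by (simp add: algebra_simps)
  qed
  finally show "metastability M K n A \<le> 1 + (\<Sum>j=2..n. lam j)" .
qed

text \<open>
  The cell vectors are an orthonormal basis of the span of the indicators, and the coordinates of the
  projection of \<open>f\<close> in this basis are the inner products with \<open>f\<close> itself.
\<close>

lemma projection_norm_square:
  assumes M: "prob_space M" and A: "measurable_partition M n A"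
    and \<Gamma>: "orthogonal_projection_onto M (indicator_span n A) \<Gamma>" and f: "f \<in> L2 M"
  shows "(L2_norm M (\<Gamma> f))\<^sup>2 = (\<Sum>i=1..n. (cmod (L2_inner M f (cell_vector M A i)))\<^sup>2)"
proof -
  let ?e = "cell_vector M A"
  note on = orthonormal_cell_vectors[OF M A]
  have e: "?e i \<in> L2 M" if "i \<in> {1..n}" for i using on that by (simp add: orthonormal_L2_def)
  from \<Gamma> f have span: "\<Gamma> f \<in> indicator_span n A"
    and orth: "\<And>v. v \<in> indicator_span n A \<Longrightarrow> L2_inner M (\<lambda>x. f x - \<Gamma> f x) v = 0"
    by (auto simp: orthogonal_projection_onto_def)
  from span obtain c where c: "\<Gamma> f = (\<lambda>x. \<Sum>i=1..n. c i * indicator (A i) x)"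
    by (auto simp: indicator_span_def)
  \<comment> \<open>the coordinates with respect to the normalised indicators\<close>
  define d where "d i = c i * of_real (sqrt (measure M (A i)))" for i
  have \<Gamma>d: "\<Gamma> f = (\<lambda>x. \<Sum>i=1..n. d i * ?e i x)"
    unfolding c
  proof (intro ext sum.cong refl)
    fix x i assume "i \<in> {1..n}"
    then have "measure M (A i) > 0" using A by (auto simp: measurable_partition_def)
    then show "c i * indicator (A i) x = d i * ?e i x" by (simp add: d_def cell_vector_def)
  qed
  have \<Gamma>L: "\<Gamma> f \<in> L2 M" unfolding \<Gamma>d by (intro L2_sum L2_scale e)
  have "L2_inner M f (?e i) = d i" if i: "i \<in> {1..n}" for i
  proof -
    have "?e i \<in> indicator_span n A"
      unfolding indicator_span_def cell_vector_def
    proof (intro CollectI exI ext)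
      fix x
      show "of_real (1 / sqrt (measure M (A i))) * indicator (A i) x
        = (\<Sum>k=1..n. (if k = i then of_real (1 / sqrt (measure M (A i))) else 0) * indicator (A k) x :: complex)"
        using i by (simp add: if_distrib[of "\<lambda>u. u * _"] cong: if_cong)
    qed
    then have "L2_inner M (\<lambda>x. f x - \<Gamma> f x) (?e i) = 0" by (rule orth)
    then have "L2_inner M f (?e i) = L2_inner M (\<Gamma> f) (?e i)"
      unfolding L2_inner_diff_left[OF f \<Gamma>L e[OF i]] by simp
    also have "\<dots> = d i" unfolding \<Gamma>d by (rule L2_inner_orthonormal_sum[OF on i])
    finally show ?thesis .
  qed
  then show ?thesis
    unfolding L2_norm_square \<Gamma>d Parseval_finite[OF on] by simp
qed

section \<open>Comparison with the Metropolis--Hastings kernels\<close>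

lemma density_measure_eq_integral:
  assumes P: "prob_space P" and dens: "has_density \<mu> P f"
  shows "integrable \<mu> f"
    and "B \<in> sets \<mu> \<Longrightarrow> measure P B = (LINT y:B|\<mu>. f y)"
proof -
  interpret prob_space P by fact
  have [measurable]: "f \<in> borel_measurable \<mu>" and nn: "\<And>y. y \<in> space \<mu> \<Longrightarrow> 0 \<le> f y"
    and eq: "P = density \<mu> (\<lambda>y. ennreal (f y))"
    using dens by (auto simp: has_density_def)
  have "(\<integral>\<^sup>+y. ennreal (f y) \<partial>\<mu>) = emeasure P (space P)"
    unfolding eq by (simp add: emeasure_density cong: nn_integral_cong)
  also have "\<dots> = 1" by (rule emeasure_space_1)
  finally show i: "integrable \<mu> f"
    using nn by (intro integrableI_nonneg) auto
  assume [measurable]: "B \<in> sets \<mu>"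
  have iB: "integrable \<mu> (\<lambda>y. indicator B y *\<^sub>R f y)"
    using i by (intro integrable_mult_indicator) auto
  have "emeasure P B = (\<integral>\<^sup>+y. ennreal (f y) * indicator B y \<partial>\<mu>)"
    unfolding eq by (simp add: emeasure_density)
  also have "\<dots> = (\<integral>\<^sup>+y. ennreal (indicator B y *\<^sub>R f y) \<partial>\<mu>)"
    by (intro nn_integral_cong) (simp add: indicator_def)
  also have "\<dots> = ennreal (LINT y:B|\<mu>. f y)"
    unfolding set_lebesgue_integral_def
    using nn by (intro nn_integral_eq_integral iB AE_I2) (simp add: indicator_def)
  finally have "ennreal (measure P B) = ennreal (LINT y:B|\<mu>. f y)"
    by (simp add: emeasure_eq_measure)
  moreover have "0 \<le> (LINT y:B|\<mu>. f y)"
    unfolding set_lebesgue_integral_def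
    using nn by (intro integral_nonneg_AE AE_I2) (simp add: indicator_def)
  ultimately show "measure P B = (LINT y:B|\<mu>. f y)" by simp
qed

text \<open>
  The comparison is made on the complement of \<open>A\<close>, where the atom at \<open>x \<in> A\<close> does not enter and only
  the densities \<open>min(p, q) \<le> p \<le> max(p, q)\<close> count. Taking complements of probability measures
  reverses the inequalities.
\<close>

lemma mh_holding_probability:
  assumes P: "prob_space P" "has_density \<mu> P (p x)" and Q: "prob_space Q" "has_density \<mu> Q (q x)"
    and x: "x \<in> A" and A: "A \<in> sets \<mu>"
    and M: "prob_space M" "sets M = sets \<mu>"
  shows "(\<And>B. B \<in> sets \<mu> \<Longrightarrow> measure M B = mh1 \<mu> p q x B) \<Longrightarrow> measure P A \<le> measure M A"
    and "(\<And>B. B \<in> sets \<mu> \<Longrightarrow> measure M B = mh2 \<mu> p q x B) \<Longrightarrow> measure M A \<le> measure P A"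
proof -
  interpret P: prob_space P by fact
  interpret M: prob_space M by fact
  define B where "B = space \<mu> - A"
  have B[measurable]: "B \<in> sets \<mu>" using A by (auto simp: B_def)
  have xB: "x \<notin> B" using x by (simp add: B_def)
  have PM: "space M = space \<mu>" "space P = space \<mu>" "sets P = sets \<mu>"
    using M(2) sets_eq_imp_space_eq P(2) by (auto simp: has_density_def)
  have compl: "measure P A = 1 - measure P B" "measure M A = 1 - measure M B"
    using P.prob_compl[of A] M.prob_compl[of A] A PM M(2) by (auto simp: B_def)
  have i: "integrable \<mu> (p x)" "integrable \<mu> (q x)"
    using density_measure_eq_integral(1) P Q by blast+
  have si: "set_integrable \<mu> B h" if "integrable \<mu> h" for h :: "_ \<Rightarrow> real"
    unfolding set_integrable_def using that by (intro integrable_mult_indicator B)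
  have PB: "measure P B = (LINT y:B|\<mu>. p x y)"
    by (rule density_measure_eq_integral(2)[OF P B])
  show "measure P A \<le> measure M A" if "\<And>B. B \<in> sets \<mu> \<Longrightarrow> measure M B = mh1 \<mu> p q x B"
  proof -
    have "measure M B = (LINT y:B|\<mu>. min (p x y) (q x y))"
      using that[OF B] xB by (simp add: mh1_def)
    also have "\<dots> \<le> (LINT y:B|\<mu>. p x y)"
      using i by (intro set_integral_mono si) auto
    finally show ?thesis using PB compl by simp
  qed
  show "measure M A \<le> measure P A" if "\<And>B. B \<in> sets \<mu> \<Longrightarrow> measure M B = mh2 \<mu> p q x B"
  proof -
    have "(LINT y:B|\<mu>. p x y) \<le> (LINT y:B|\<mu>. max (p x y) (q x y))"
      using i by (intro set_integral_mono si) auto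
    also have "\<dots> = measure M B"
      using that[OF B] xB by (simp add: mh2_def)
    finally show ?thesis using PB compl by simp
  qed
qed

lemma metastability_mono:
  assumes M: "prob_space M" and K: "markov_kernel M K" and L: "markov_kernel M L"
    and A: "measurable_partition M n A"
    and le: "\<And>i x. i \<in> {1..n} \<Longrightarrow> x \<in> A i \<Longrightarrow> measure (K x) (A i) \<le> measure (L x) (A i)"
  shows "metastability M K n A \<le> metastability M L n A"
  unfolding metastability_def
proof (rule sum_mono)
  interpret prob_space M by fact
  fix i assume i: "i \<in> {1..n}"
  have Ai[measurable]: "A i \<in> sets M" using A i by (auto simp: measurable_partition_def)
  have int: "set_integrable M (A i) (\<lambda>x. measure (K x) (A i))" if K: "markov_kernel M K" for K
  proof -
    have Km: "K \<in> M \<rightarrow>\<^sub>M prob_algebra M" using K by (simp add: markov_kernel_def)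
    have "(\<lambda>x. measure (K x) (A i)) \<in> borel_measurable M"
      using measure_measurable_prob_algebra2[of M "\<lambda>_. A i" M K] Km by simp
    then have "integrable M (\<lambda>x. measure (K x) (A i))"
      by (intro integrable_const_bound[where B = 1])
        (use markov_kernelD[OF K] in \<open>auto intro!: AE_I2 prob_space.prob_le_1\<close>)
    then show ?thesis
      unfolding set_integrable_def by (intro integrable_mult_indicator Ai)
  qed
  have "(LINT x:A i|M. measure (K x) (A i)) \<le> (LINT x:A i|M. measure (L x) (A i))"
    using le[OF i] by (intro set_integral_mono int K L) auto
  then show "transition_prob M K (A i) (A i) \<le> transition_prob M L (A i) (A i)"
    unfolding transition_prob_def by (auto intro: mult_left_mono divide_right_mono)
qed

theorem theorem7p2:
  fixes \<mu> \<pi> :: "'a measure"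
    and P Pstar M1 M2 :: "'a \<Rightarrow> 'a measure"
    and p pstar :: "'a \<Rightarrow> 'a \<Rightarrow> real" and pi_dens :: "'a \<Rightarrow> real"
    and n :: nat
    and lam1 lam2 :: "nat \<Rightarrow> real" and \<phi>1 \<phi>2 :: "nat \<Rightarrow> 'a \<Rightarrow> complex"
    and a1 b1 a2 b2 :: real
    and A :: "nat \<Rightarrow> 'a set"
    and \<Gamma> :: "('a \<Rightarrow> complex) \<Rightarrow> ('a \<Rightarrow> complex)"
  assumes "prob_space \<pi>" and "sets \<pi> = sets \<mu>"
    and "markov_kernel \<pi> P" and "stationary \<pi> P"
    and "\<not> reversible \<pi> P" and "phi_irreducible \<pi> P"
    and "markov_kernel \<pi> Pstar" and "time_reversal \<pi> P Pstar"
    and "\<And>x. x \<in> space \<mu> \<Longrightarrow> has_density \<mu> (P x) (p x)"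
    and "\<And>x. x \<in> space \<mu> \<Longrightarrow> has_density \<mu> (Pstar x) (pstar x)"
    and "has_density \<mu> \<pi> pi_dens"
    and "{x \<in> space \<mu>. pi_dens x = 0} \<in> null_sets \<mu>"
    and "represents_kernel \<mu> M1 (mh1 \<mu> p pstar)"
    and "represents_kernel \<mu> M2 (mh2 \<mu> p pstar)"
    and "dominant_eigenvalues \<pi> M1 n lam1 \<phi>1 a1 b1"
    and "dominant_eigenvalues \<pi> M2 n lam2 \<phi>2 a2 b2"
    and "measurable_partition \<pi> n A"
    and "orthogonal_projection_onto \<pi> (indicator_span n A) \<Gamma>"
  shows "let \<rho> = (\<lambda>j. (L2_norm \<pi> (\<Gamma> (\<phi>2 j)))\<^sup>2);
             c = a2 * (\<Sum>j=2..n. 1 - \<rho> j)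
         in (\<forall>j\<in>{2..n}. \<rho> j \<in> {0..1}) \<and>
            1 + (\<Sum>j=2..n. \<rho> j * lam2 j) + c \<le> metastability \<pi> P n A \<and>
            metastability \<pi> P n A \<le> 1 + (\<Sum>j=2..n. lam1 j)"
proof -
  note M = assms(1) and P = assms(3) and Pstar = assms(7)
    and dom1 = assms(15) and dom2 = assms(16) and A = assms(17)
  have sp: "space \<pi> = space \<mu>" using assms(2) by (rule sets_eq_imp_space_eq)
  have M1: "markov_kernel \<pi> M1" and M2: "markov_kernel \<pi> M2"
    using dom1 dom2 unfolding dominant_eigenvalues_def by blast+
  have cell: "x \<in> space \<pi>" "A i \<in> sets \<mu>" if "i \<in> {1..n}" "x \<in> A i" for i x
    using A that assms(2) sets.sets_into_space[of "A i" \<pi>] by (auto simp: measurable_partition_def)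
  have low: "metastability \<pi> M2 n A \<le> metastability \<pi> P n A"
  proof (rule metastability_mono[OF M M2 P A])
    fix i x assume ix: "i \<in> {1..n}" "x \<in> A i"
    note x = cell(1)[OF ix] and Ai = cell(2)[OF ix]
    have xm: "x \<in> space \<mu>" using x sp by simp
    have "sets (M2 x) = sets \<mu>" using markov_kernelD(2)[OF M2 x] assms(2) by simp
    moreover have "\<And>B. B \<in> sets \<mu> \<Longrightarrow> measure (M2 x) B = mh2 \<mu> p pstar x B"
      using assms(14) xm by (simp add: represents_kernel_def)
    ultimately show "measure (M2 x) (A i) \<le> measure (P x) (A i)"
      using mh_holding_probability(2)[where p = p and q = pstar and x = x, OF markov_kernelD(1)[OF P x] assms(9)[OF xm]
          markov_kernelD(1)[OF Pstar x] assms(10)[OF xm] ix(2) Ai markov_kernelD(1)[OF M2 x]]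
      by blast
  qed
  have up: "metastability \<pi> P n A \<le> metastability \<pi> M1 n A"
  proof (rule metastability_mono[OF M P M1 A])
    fix i x assume ix: "i \<in> {1..n}" "x \<in> A i"
    note x = cell(1)[OF ix] and Ai = cell(2)[OF ix]
    have xm: "x \<in> space \<mu>" using x sp by simp
    have "sets (M1 x) = sets \<mu>" using markov_kernelD(2)[OF M1 x] assms(2) by simp
    moreover have "\<And>B. B \<in> sets \<mu> \<Longrightarrow> measure (M1 x) B = mh1 \<mu> p pstar x B"
      using assms(13) xm by (simp add: represents_kernel_def)
    ultimately show "measure (P x) (A i) \<le> measure (M1 x) (A i)"
      using mh_holding_probability(1)[where p = p and q = pstar and x = x, OF markov_kernelD(1)[OF P x] assms(9)[OF xm]
          markov_kernelD(1)[OF Pstar x] assms(10)[OF xm] ix(2) Ai markov_kernelD(1)[OF M1 x]]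
      by blast
  qed
  have \<phi>2: "\<phi>2 j \<in> L2 \<pi>" if "j \<in> {2..n}" for j
    using dom2 that unfolding dominant_eigenvalues_def by auto
  have \<rho>: "(L2_norm \<pi> (\<Gamma> (\<phi>2 j)))\<^sup>2 = (\<Sum>i=1..n. (cmod (L2_inner \<pi> (\<phi>2 j) (cell_vector \<pi> A i)))\<^sup>2)"
    if "j \<in> {2..n}" for j
    by (rule projection_norm_square[OF M A assms(18) \<phi>2[OF that]])
  have "(L2_norm \<pi> (\<Gamma> (\<phi>2 j)))\<^sup>2 \<in> {0..1}" if "j \<in> {2..n}" for j
    using selfadjoint_metastability_bounds(1)[OF M dom2 A, of j] that unfolding \<rho>[OF that] by simp
  moreover have "1 + (\<Sum>j=2..n. (L2_norm \<pi> (\<Gamma> (\<phi>2 j)))\<^sup>2 * lam2 j)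
      + a2 * (\<Sum>j=2..n. 1 - (L2_norm \<pi> (\<Gamma> (\<phi>2 j)))\<^sup>2) \<le> metastability \<pi> P n A"
  proof -
    let ?r = "\<lambda>j. \<Sum>i=1..n. (cmod (L2_inner \<pi> (\<phi>2 j) (cell_vector \<pi> A i)))\<^sup>2"
    have "(\<Sum>j=2..n. (L2_norm \<pi> (\<Gamma> (\<phi>2 j)))\<^sup>2 * lam2 j) = (\<Sum>j=2..n. ?r j * lam2 j)"
      by (rule sum.cong[OF refl]) (simp only: \<rho>)
    moreover have "(\<Sum>j=2..n. 1 - (L2_norm \<pi> (\<Gamma> (\<phi>2 j)))\<^sup>2) = (\<Sum>j=2..n. 1 - ?r j)"
      by (rule sum.cong[OF refl]) (simp only: \<rho>)
    ultimately show ?thesis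
      using selfadjoint_metastability_bounds(2)[OF M dom2 A] low by simp
  qed
  moreover have "metastability \<pi> P n A \<le> 1 + (\<Sum>j=2..n. lam1 j)"
    using selfadjoint_metastability_bounds(3)[OF M dom1 A] up by simp
  ultimately show ?thesis unfolding Let_def by blast
qed

end
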